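(* Let $D$ be a free discrete group with finite basis $\{x_1,\ldots,x_n\}$. Then the set of test elements of $D$ is a dense subset of $D$ in the profinite topology.
   Context: An element $g$ of a group $G$ is a test element of $G$ if every endomorphism $\varphi:G\to G$ with $\varphi(g)=g$ is an automorphism. The profinite topology on a group $G$ has as a basis the cosets $gN$ with $g\in G$ and $N$ a normal subgroup of finite index in $G$. *)

theory Defs
  imports "HOL-Analysis.Abstract_Topology" "HOL-Algebra.Generated_Groups"
begin

text \<open>
  The pair \<^term>\<open>(x, True)\<close> stands for the letter $x$ and \<^term>\<open>(x, False)\<close> for its formal
  inverse $x^{-1}$.
\<close>

definition reduced_word :: "('a \<times> bool) list \<Rightarrow> bool" where
  "reduced_word = successively (\<lambda>u v. \<not> (fst u = fst v \<and> snd u \<noteq> snd v))"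

definition letter_value :: "('a, 'b) monoid_scheme \<Rightarrow> 'a \<times> bool \<Rightarrow> 'a" where
  "letter_value G u = (if snd u then fst u else inv\<^bsub>G\<^esub> (fst u))"

definition word_value :: "('a, 'b) monoid_scheme \<Rightarrow> ('a \<times> bool) list \<Rightarrow> 'a" where
  "word_value G w = foldr (\<lambda>u g. letter_value G u \<otimes>\<^bsub>G\<^esub> g) w \<one>\<^bsub>G\<^esub>"

text \<open>
  A group is free with basis \<open>X\<close> if each of its elements is the value of exactly one reduced
  word over \<open>X\<close> and the formal inverses of its elements.
\<close>

definition free_group_with_basis :: "('a, 'b) monoid_scheme \<Rightarrow> 'a set \<Rightarrow> bool" where
  "free_group_with_basis G X \<longleftrightarrow> group G \<and> X \<subseteq> carrier G \<and>
     bij_betw (word_value G) {w. fst ` set w \<subseteq> X \<and> reduced_word w} (carrier G)"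

text \<open>This notion of freeness yields the universal property, for groups of arbitrary type.\<close>

lemma letter_value_closed:
  assumes "group G" "fst u \<in> carrier G"
  shows "letter_value G u \<in> carrier G"
  using assms by (auto simp: letter_value_def group.inv_closed)

lemma word_value_simps:
  "word_value G [] = \<one>\<^bsub>G\<^esub>"
  "word_value G (u # w) = letter_value G u \<otimes>\<^bsub>G\<^esub> word_value G w"
  by (simp_all add: word_value_def)

lemma word_value_closed:
  assumes "group G" "fst ` set w \<subseteq> carrier G"
  shows "word_value G w \<in> carrier G"
proof -
  interpret group G by fact
  show ?thesis
    using assms(2) by (induction w) (auto simp: word_value_simps letter_value_closed[OF assms(1)])
qed

lemma word_value_append:
  assumes "group G" "fst ` set v \<subseteq> carrier G" "fst ` set w \<subseteq> carrier G"
  shows "word_value G (v @ w) = word_value G v \<otimes>\<^bsub>G\<^esub> word_value G w"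
proof -
  interpret group G by fact
  have w: "word_value G w \<in> carrier G"
    by (rule word_value_closed[OF assms(1,3)])
  show ?thesis
    using assms(2)
    by (induction v)
       (auto simp: word_value_simps letter_value_closed[OF assms(1)] m_assoc
          word_value_closed[OF assms(1)] w image_subset_iff)
qed

lemma word_value_cancel:
  assumes "group G" "fst ` set w \<subseteq> carrier G" "x \<in> carrier G"
  shows "word_value G ((x, b) # (x, \<not> b) # w) = word_value G w"
proof -
  interpret group G by fact
  have w: "word_value G w \<in> carrier G"
    by (rule word_value_closed[OF assms(1,2)])
  show ?thesis
    using assms(3) w by (cases b) (simp_all add: word_value_simps letter_value_def flip: m_assoc)
qed

lemma exists_reduced_word:
  assumes G: "group G" "X \<subseteq> carrier G" and H: "group H" "f ` X \<subseteq> carrier H"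
    and w: "fst ` set w \<subseteq> X"
  shows "\<exists>v. fst ` set v \<subseteq> X \<and> reduced_word v \<and> word_value G v = word_value G w \<and>
             word_value H (map (apfst f) v) = word_value H (map (apfst f) w)"
  using w
proof (induction w)
  case Nil
  show ?case by (intro exI[of _ "[]"]) (simp add: reduced_word_def)
next
  case (Cons u w)
  then obtain v where v: "fst ` set v \<subseteq> X" "reduced_word v" "word_value G v = word_value G w"
    "word_value H (map (apfst f) v) = word_value H (map (apfst f) w)"
    by auto
  have u: "fst u \<in> X" using Cons.prems by simp
  have uv: "word_value G (u # v) = word_value G (u # w)"
    "word_value H (map (apfst f) (u # v)) = word_value H (map (apfst f) (u # w))"
    by (simp_all add: word_value_simps v)
  show ?case
  proof (cases "reduced_word (u # v)")
    case True
    then show ?thesis using uv u v by (intro exI[of _ "u # v"]) auto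
  next
    case False
    then obtain v' where v': "v = (fst u, \<not> snd u) # v'"
      using v(2) by (cases v) (auto simp: reduced_word_def prod_eq_iff)
    have red: "reduced_word v'"
      using v(2) unfolding v' by (cases v') (auto simp: reduced_word_def)
    have sub: "fst ` set v' \<subseteq> X" using v(1) v' by auto
    have "word_value G (u # v) = word_value G v'"
      using word_value_cancel[OF G(1), of v' "fst u" "snd u"] sub u G(2) v' by auto
    moreover have "word_value H (map (apfst f) (u # v)) = word_value H (map (apfst f) v')"
      using word_value_cancel[OF H(1), of "map (apfst f) v'" "f (fst u)" "snd u"] sub u H(2) v'
      by (auto simp: apfst_def map_prod_def image_subset_iff split_beta)
    ultimately show ?thesis using uv red sub by (intro exI[of _ v']) auto
  qed
qed

lemma free_group_with_basis_extend:
  assumes free: "free_group_with_basis G X" and H: "group H" "f ` X \<subseteq> carrier H"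
  shows "\<exists>h \<in> hom G H. \<forall>x \<in> X. h x = f x"
proof -
  define R where "R = {w. fst ` set w \<subseteq> X \<and> reduced_word w}"
  define r where "r = inv_into R (word_value G)"
  define h where "h = (\<lambda>g. word_value H (map (apfst f) (r g)))"
  have G: "group G" "X \<subseteq> carrier G" and bij: "bij_betw (word_value G) R (carrier G)"
    using free by (auto simp: free_group_with_basis_def R_def)
  have r: "r g \<in> R" "word_value G (r g) = g" if "g \<in> carrier G" for g
    using bij that unfolding r_def
    by (metis bij_betw_def inv_into_into, metis bij_betw_inv_into_right)
  have fX: "fst ` set (map (apfst f) w) \<subseteq> carrier H" if "fst ` set w \<subseteq> X" for w
    using that H(2) by fastforce
  have h: "h (word_value G w) = word_value H (map (apfst f) w)" if w: "fst ` set w \<subseteq> X" for w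
  proof -
    obtain v where v: "v \<in> R" "word_value G v = word_value G w"
      "word_value H (map (apfst f) v) = word_value H (map (apfst f) w)"
      using exists_reduced_word[OF G H w] unfolding R_def by auto
    have "r (word_value G w) = v"
      using v bij unfolding r_def by (metis bij_betw_inv_into_left)
    then show ?thesis using v by (simp add: h_def)
  qed
  have "h \<in> hom G H"
  proof (rule homI)
    fix x assume "x \<in> carrier G"
    then show "h x \<in> carrier H"
      unfolding h_def using r(1) by (intro word_value_closed[OF H(1)] fX) (simp add: R_def)
  next
    fix x y assume x: "x \<in> carrier G" and y: "y \<in> carrier G"
    have X: "fst ` set (r x) \<subseteq> X" "fst ` set (r y) \<subseteq> X"
      using r x y by (auto simp: R_def)
    have "word_value G (r x @ r y) = word_value G (r x) \<otimes>\<^bsub>G\<^esub> word_value G (r y)"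
      using word_value_append[OF G(1)] X G(2) by (meson subset_trans)
    then have "h (x \<otimes>\<^bsub>G\<^esub> y) = word_value H (map (apfst f) (r x @ r y))"
      using h[of "r x @ r y"] X r x y by auto
    also have "\<dots> = h x \<otimes>\<^bsub>H\<^esub> h y"
      unfolding map_append h_def by (rule word_value_append[OF H(1) fX fX]) (rule X)+
    finally show "h (x \<otimes>\<^bsub>G\<^esub> y) = h x \<otimes>\<^bsub>H\<^esub> h y" .
  qed
  moreover have "h x = f x" if x: "x \<in> X" for x
  proof -
    have xG: "x \<in> carrier G" and fxH: "f x \<in> carrier H" using x G(2) H(2) by auto
    have "word_value G [(x, True)] = x" "word_value H [(f x, True)] = f x"
      using xG fxH G(1) H(1)
      by (simp_all add: word_value_simps letter_value_def group.is_monoid monoid.r_one)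
    then show ?thesis using h[of "[(x, True)]"] x by simp
  qed
  ultimately show ?thesis by blast
qed

lemma free_group_with_basis_unique:
  assumes free: "free_group_with_basis G X" and H: "group H"
    and h: "h \<in> hom G H" "k \<in> hom G H" "\<And>x. x \<in> X \<Longrightarrow> h x = k x" and g: "g \<in> carrier G"
  shows "h g = k g"
proof -
  have G: "group G" "X \<subseteq> carrier G" 
    and bij: "bij_betw (word_value G) {w. fst ` set w \<subseteq> X \<and> reduced_word w} (carrier G)"
    using free by (auto simp: free_group_with_basis_def)
  have hk: "group_hom G H h" "group_hom G H k"
    using G H h by (auto simp: group_hom_def group_hom_axioms_def)
  have eq: "h (word_value G w) = k (word_value G w)" if "fst ` set w \<subseteq> X" for w
    using that
  proof (induction w)
    case Nil
    then show ?case by (simp add: word_value_simps group_hom.hom_one[OF hk(1)] group_hom.hom_one[OF hk(2)])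
  next
    case (Cons u w)
    have u: "fst u \<in> carrier G" "fst u \<in> X" using Cons.prems G(2) by auto
    have w: "word_value G w \<in> carrier G"
      using Cons.prems G by (intro word_value_closed) auto
    have "h (letter_value G u) = k (letter_value G u)"
      using u h(3) group_hom.hom_inv[OF hk(1)] group_hom.hom_inv[OF hk(2)]
      by (auto simp: letter_value_def)
    then show ?case
      using Cons letter_value_closed[OF G(1) u(1)] w
      by (simp add: word_value_simps hom_mult[OF h(1)] hom_mult[OF h(2)])
  qed
  obtain w where "fst ` set w \<subseteq> X" "g = word_value G w"
    using bij g unfolding bij_betw_def by blast
  then show ?thesis using eq by simp
qed

definition test_element :: "('a, 'b) monoid_scheme \<Rightarrow> 'a \<Rightarrow> bool" where
  "test_element G g \<longleftrightarrow> g \<in> carrier G \<and> (\<forall>\<phi> \<in> hom G G. \<phi> g = g \<longrightarrow> \<phi> \<in> iso G G)"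

definition profinite_basic :: "('a, 'b) monoid_scheme \<Rightarrow> 'a set \<Rightarrow> bool" where
  "profinite_basic G U \<longleftrightarrow>
     (\<exists>g N. g \<in> carrier G \<and> N \<lhd> G \<and> finite (rcosets\<^bsub>G\<^esub> N) \<and> U = g <#\<^bsub>G\<^esub> N)"

definition profinite_topology :: "('a, 'b) monoid_scheme \<Rightarrow> 'a topology" where
  "profinite_topology G = topology (arbitrary union_of (profinite_basic G))"

text \<open>
  For a group \<open>G\<close>, the sets in \<^const>\<open>profinite_basic\<close> do form the basis of a topology on
  the carrier; \<^const>\<open>topology\<close> is only meaningful under this condition.
\<close>

lemma finite_rcosets_Int:
  assumes "group G" "N \<lhd> G" "M \<lhd> G" "finite (rcosets\<^bsub>G\<^esub> N)" "finite (rcosets\<^bsub>G\<^esub> M)"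
  shows "finite (rcosets\<^bsub>G\<^esub> (N \<inter> M))"
proof (rule finite_subset)
  show "rcosets\<^bsub>G\<^esub> (N \<inter> M) \<subseteq> (\<lambda>(A, B). A \<inter> B) ` ((rcosets\<^bsub>G\<^esub> N) \<times> (rcosets\<^bsub>G\<^esub> M))"
  proof
    fix C assume "C \<in> rcosets\<^bsub>G\<^esub> (N \<inter> M)"
    then obtain a where a: "a \<in> carrier G" "C = (N \<inter> M) #>\<^bsub>G\<^esub> a"
      by (auto simp: RCOSETS_def)
    have NM: "N \<subseteq> carrier G" "M \<subseteq> carrier G"
      using assms normal_imp_subgroup subgroup.subset by blast+
    have "C = (N #>\<^bsub>G\<^esub> a) \<inter> (M #>\<^bsub>G\<^esub> a)"
    proof
      show "(N #>\<^bsub>G\<^esub> a) \<inter> (M #>\<^bsub>G\<^esub> a) \<subseteq> C"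
      proof
        fix y assume "y \<in> (N #>\<^bsub>G\<^esub> a) \<inter> (M #>\<^bsub>G\<^esub> a)"
        then obtain n m where nm: "n \<in> N" "m \<in> M" "y = n \<otimes>\<^bsub>G\<^esub> a" "y = m \<otimes>\<^bsub>G\<^esub> a"
          by (auto simp: r_coset_def)
        then have "n = m"
          using a NM by (metis assms(1) group.right_cancel subsetD)
        then show "y \<in> C" using nm a by (auto simp: r_coset_def)
      qed
    qed (auto simp: a r_coset_def)
    then show "C \<in> (\<lambda>(A, B). A \<inter> B) ` ((rcosets\<^bsub>G\<^esub> N) \<times> (rcosets\<^bsub>G\<^esub> M))"
      using a by (auto simp: RCOSETS_def)
  qed
qed (use assms in auto)

lemma l_coset_of_member:
  assumes "group G" "N \<lhd> G" "g \<in> carrier G" "k \<in> g <#\<^bsub>G\<^esub> N"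
  shows "k \<in> carrier G" "g <#\<^bsub>G\<^esub> N = k <#\<^bsub>G\<^esub> N"
proof -
  have N: "subgroup N G" using assms normal_imp_subgroup by blast
  show "k \<in> carrier G"
    using assms group.l_coset_carrier[OF assms(1) assms(4,3) N] by blast
  show "g <#\<^bsub>G\<^esub> N = k <#\<^bsub>G\<^esub> N"
    using group.l_repr_independence[OF assms(1) assms(4,3) N] .
qed

lemma istopology_profinite_basic:
  assumes "group G"
  shows "istopology (arbitrary union_of (profinite_basic G))"
  unfolding istopology_base_eq
proof (intro allI impI, elim conjE)
  fix S T assume S: "profinite_basic G S" and T: "profinite_basic G T"
  obtain g N where N: "g \<in> carrier G" "N \<lhd> G" "finite (rcosets\<^bsub>G\<^esub> N)" "S = g <#\<^bsub>G\<^esub> N"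
    using S by (auto simp: profinite_basic_def)
  obtain h M where M: "h \<in> carrier G" "M \<lhd> G" "finite (rcosets\<^bsub>G\<^esub> M)" "T = h <#\<^bsub>G\<^esub> M"
    using T by (auto simp: profinite_basic_def)
  have NM: "N \<inter> M \<lhd> G" "finite (rcosets\<^bsub>G\<^esub> (N \<inter> M))"
    using finite_rcosets_Int[OF assms] group.normal_subgroup_intersect[OF assms] N M by auto
  show "(arbitrary union_of profinite_basic G) (S \<inter> T)"
    unfolding arbitrary_union_of_alt
  proof
    fix k assume k: "k \<in> S \<inter> T"
    have kc: "k \<in> carrier G" and ST: "S = k <#\<^bsub>G\<^esub> N" "T = k <#\<^bsub>G\<^esub> M"
      using l_coset_of_member[OF assms] N M k by blast+
    have "k \<in> k <#\<^bsub>G\<^esub> (N \<inter> M)"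
      using NM(1) kc assms normal_imp_subgroup subgroup.one_closed group.is_monoid monoid.r_one
      unfolding l_coset_def by (smt (verit) UN_iff singleton_iff)
    moreover have "k <#\<^bsub>G\<^esub> (N \<inter> M) \<subseteq> S \<inter> T"
      by (auto simp: ST l_coset_def)
    ultimately show "\<exists>U. profinite_basic G U \<and> k \<in> U \<and> U \<subseteq> S \<inter> T"
      using NM kc unfolding profinite_basic_def by blast
  qed
qed

lemma openin_profinite_topology:
  assumes "group G"
  shows "openin (profinite_topology G) = arbitrary union_of (profinite_basic G)"
  using istopology_profinite_basic[OF assms] by (simp add: profinite_topology_def)

lemma topspace_profinite_topology:
  assumes "group G"
  shows "topspace (profinite_topology G) = carrier G"
proof
  show "topspace (profinite_topology G) \<subseteq> carrier G"
  proof
    fix x assume "x \<in> topspace (profinite_topology G)"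
    then obtain U where "profinite_basic G U" "x \<in> U"
      unfolding topspace_def openin_profinite_topology[OF assms] arbitrary_union_of_alt by blast
    then show "x \<in> carrier G"
      using l_coset_of_member(1)[OF assms] by (auto simp: profinite_basic_def)
  qed
  have one: "\<one>\<^bsub>G\<^esub> \<in> carrier G"
    using assms by (simp add: group.is_monoid)
  have "carrier G \<lhd> G"
    using assms by (rule group.normal_self)
  moreover have "rcosets\<^bsub>G\<^esub> (carrier G) = {carrier G}"
    using one group.coset_join2[OF assms _ group.subgroup_self[OF assms]]
    by (auto simp: RCOSETS_def)
  moreover have "\<one>\<^bsub>G\<^esub> <#\<^bsub>G\<^esub> carrier G = carrier G"
    using assms by (simp add: group.lcos_mult_one)
  ultimately have "profinite_basic G (carrier G)"
    unfolding profinite_basic_def using one by (metis finite.emptyI finite.insertI)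
  then have "openin (profinite_topology G) (carrier G)"
    unfolding openin_profinite_topology[OF assms] by (simp add: arbitrary_union_of_inc)
  then show "carrier G \<subseteq> topspace (profinite_topology G)"
    by (rule openin_subset)
qed

end

theory Submission
  imports Defs "HOL-Algebra.Bij" "HOL-Algebra.Elementary_Groups" "HOL-Algebra.Multiplicative_Group"
    "HOL-Number_Theory.Cong"
    "HOL-Computational_Algebra.Primes" "HOL-Library.Sublist"
begin

text \<open>
  Given a coset \<open>gN\<close> of index \<open>m\<close> and a prime \<open>p\<close> not dividing \<open>m\<close>, put
  \<open>y = x\<^sub>1\<^sup>p \<cdots> x\<^sub>n\<^sup>p\<close> and \<open>h = g (g\<inverse> y)\<^sup>c\<close> with \<open>m\<close> dividing \<open>c\<close> and \<open>c \<equiv> 1\<close>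
  modulo \<open>p\<^sup>2\<close>. Then \<open>h \<in> gN\<close>, and no homomorphism to the wreath product of two groups of order
  \<open>p\<close>, whose exponent is \<open>p\<^sup>2\<close>, can tell \<open>h\<close> from \<open>y\<close>. A suitable such homomorphism shows that
  the image of an endomorphism fixing \<open>h\<close> lies in the kernel of no nonzero homomorphism to
  \<open>\<int>/p\<close>.

  For such an endomorphism \<open>\<psi>\<close>, composition with \<open>\<psi>\<close> is injective on the \<open>\<int>/p\<close>-valued polynomial
  functions of each degree, hence bijective, as there are finitely many of them. They separate the
  points of a free group, so \<open>\<psi>\<close> is injective.

  Now let \<open>\<phi>\<close> fix \<open>h\<close> and let \<open>H\<close> be the image of \<open>\<phi>\<^sup>k\<close>. The loop spelled by \<open>h\<close> in the Schreier
  graph of \<open>H\<close> visits a finite set of vertices, which spans a subgraph with fundamental group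
  \<open>L \<le> H\<close>. Collapsing all other edges retracts \<open>H\<close> onto \<open>L\<close>. Composed with \<open>\<phi>\<^sup>k\<close> this is
  an endomorphism fixing \<open>h\<close>, and polynomial functions show that the retraction is the identity,
  so \<open>H = L\<close>. But \<open>L\<close> is generated by elements from a finite set independent of \<open>k\<close>. Hence
  \<open>\<phi>\<^sup>k\<close> and \<open>\<phi>\<^sup>l\<close> have the same image for some \<open>k < l\<close>, and \<open>\<phi>\<close> is surjective.
\<close>

section \<open>Cocycles on free groups\<close>

locale free_group_basis = group G for G :: "('a, 'b) monoid_scheme" (structure) +
  fixes X :: "'a set"
  assumes free: "free_group_with_basis G X"
begin

lemma basis_closed: "X \<subseteq> carrier G"
  using free by (simp add: free_group_with_basis_def)

lemma basis_memD [simp]: "x \<in> X \<Longrightarrow> x \<in> carrier G"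
  using basis_closed by blast

lemma letter_value_simps [simp]:
  "letter_value G (x, True) = x" "letter_value G (x, False) = inv x"
  by (simp_all add: letter_value_def)

lemma obtain_reduced_word:
  assumes "u \<in> carrier G"
  obtains w where "fst ` set w \<subseteq> X" "reduced_word w" "word_value G w = u"
proof -
  have "u \<in> word_value G ` {w. fst ` set w \<subseteq> X \<and> reduced_word w}"
    using assms free by (simp add: free_group_with_basis_def bij_betw_def)
  then show ?thesis using that by blast
qed

lemma free_induct [consumes 1, case_names one gen inv]:
  assumes u: "u \<in> carrier G" and one: "P \<one>"
    and gen: "\<And>x v. x \<in> X \<Longrightarrow> v \<in> carrier G \<Longrightarrow> P v \<Longrightarrow> P (x \<otimes> v)"
    and inv: "\<And>x v. x \<in> X \<Longrightarrow> v \<in> carrier G \<Longrightarrow> P v \<Longrightarrow> P (inv x \<otimes> v)"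
  shows "P u"
proof -
  have *: "P (word_value G w)" if "fst ` set w \<subseteq> X" for w
    using that
  proof (induction w)
    case Nil
    then show ?case by (simp add: word_value_simps one)
  next
    case (Cons a w)
    obtain x b where a: "a = (x, b)" by force
    have "word_value G w \<in> carrier G"
      using Cons.prems basis_closed by (intro word_value_closed is_group) auto
    then show ?case
      using Cons gen inv by (cases b) (auto simp: a word_value_simps)
  qed
  obtain w where "fst ` set w \<subseteq> X" "word_value G w = u"
    using u by (rule obtain_reduced_word)
  then show ?thesis using * by blast
qed

text \<open>Freeness leaves \<open>g\<close> arbitrary: for each basis element \<open>x\<close>,
  sending \<open>(v, m)\<close> to \<open>(x \<otimes> v, g x v \<otimes> m)\<close> is a bijection
  of the product of the carriers, so the universal property turns these maps into an action of
  \<open>G\<close>. \<open>R u\<close> is the second coordinate of the image of the pair of units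
  under \<open>u\<close>.\<close>

lemma exists_cocycle:
  assumes M: "group M" and g: "\<And>x v. x \<in> X \<Longrightarrow> v \<in> carrier G \<Longrightarrow> g x v \<in> carrier M"
  obtains R where "\<And>v. v \<in> carrier G \<Longrightarrow> R v \<in> carrier M" "R \<one> = \<one>\<^bsub>M\<^esub>"
    "\<And>x v. x \<in> X \<Longrightarrow> v \<in> carrier G \<Longrightarrow> R (x \<otimes> v) = g x v \<otimes>\<^bsub>M\<^esub> R v"
proof -
  interpret M: group M by fact
  define S where "S = carrier G \<times> carrier M"
  define b where "b = (\<lambda>x. \<lambda>q\<in>S. (x \<otimes> fst q, g x (fst q) \<otimes>\<^bsub>M\<^esub> snd q))"
  define b' where "b' = (\<lambda>x q. (inv x \<otimes> fst q, inv\<^bsub>M\<^esub> g x (inv x \<otimes> fst q) \<otimes>\<^bsub>M\<^esub> snd q))"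
  have b: "b x \<in> Bij S" if x: "x \<in> X" for x
  proof -
    have "bij_betw (b x) S S"
    proof (rule bij_betw_byWitness[where f' = "b' x"])
      show "\<forall>a\<in>S. b' x (b x a) = a" "\<forall>a\<in>S. b x (b' x a) = a"
        using x g[OF x] by (auto simp: b_def b'_def S_def simp flip: m_assoc M.m_assoc)
      show "b x ` S \<subseteq> S" "b' x ` S \<subseteq> S"
        using x g[OF x] by (auto simp: b_def b'_def S_def)
    qed
    then show ?thesis by (auto simp: Bij_def b_def)
  qed
  interpret B: group "BijGroup S" by (rule group_BijGroup)
  have "b ` X \<subseteq> carrier (BijGroup S)" using b by (auto simp: BijGroup_def)
  from free_group_with_basis_extend[OF free group_BijGroup this]
  obtain \<theta> where \<theta>: "\<theta> \<in> hom G (BijGroup S)" "\<And>x. x \<in> X \<Longrightarrow> \<theta> x = b x" by blast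
  have \<theta>B: "\<theta> u \<in> Bij S" if "u \<in> carrier G" for u
    using \<theta>(1) that by (auto simp: hom_def BijGroup_def)
  have \<theta>m: "\<theta> (u \<otimes> v) q = \<theta> u (\<theta> v q)"
    if "u \<in> carrier G" "v \<in> carrier G" "q \<in> S" for u v q
    using hom_mult[OF \<theta>(1) that(1,2)] \<theta>B that by (simp add: BijGroup_def compose_def)
  have \<theta>S: "\<theta> u q \<in> S" if "u \<in> carrier G" "q \<in> S" for u q
    using \<theta>B[OF that(1)] that(2) by (auto simp: Bij_def bij_betw_def)
  have one: "(\<one>, \<one>\<^bsub>M\<^esub>) \<in> S" by (simp add: S_def)
  have \<theta>1: "\<theta> \<one> q = q" if "q \<in> S" for q
    using hom_one[OF \<theta>(1) is_group group_BijGroup] that by (simp add: BijGroup_def)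
  \<comment> \<open>The first coordinate records the group element reached so far, so that
    \<open>g x\<close> gets evaluated at \<open>v\<close> when \<open>x\<close> acts after
    \<open>v\<close>.\<close>
  have fst: "fst (\<theta> u (\<one>, \<one>\<^bsub>M\<^esub>)) = u" if "u \<in> carrier G" for u
    using that
  proof (induction rule: free_induct)
    case one
    then show ?case using \<theta>1 \<open>(\<one>, \<one>\<^bsub>M\<^esub>) \<in> S\<close> by simp
  next
    case (gen x v)
    then show ?case
      using \<theta>m[OF _ _ one, of x v] \<theta>S[OF _ one, of v] by (simp add: \<theta>(2) b_def)
  next
    case (inv x v)
    let ?v = "inv x \<otimes> v"
    have "v = fst (\<theta> (x \<otimes> ?v) (\<one>, \<one>\<^bsub>M\<^esub>))"
      using inv by (simp flip: m_assoc)
    also have "\<dots> = x \<otimes> fst (\<theta> ?v (\<one>, \<one>\<^bsub>M\<^esub>))"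
      using inv \<theta>m[OF _ _ one, of x ?v] \<theta>S[OF _ one, of ?v] by (simp add: \<theta>(2) b_def)
    finally have "?v = inv x \<otimes> (x \<otimes> fst (\<theta> ?v (\<one>, \<one>\<^bsub>M\<^esub>)))" by simp
    moreover have "fst (\<theta> ?v (\<one>, \<one>\<^bsub>M\<^esub>)) \<in> carrier G"
      using \<theta>S[OF _ one, of ?v] inv by (auto simp: S_def)
    ultimately show ?case using inv by (simp flip: m_assoc)
  qed
  show ?thesis
  proof (rule that[of "\<lambda>u. snd (\<theta> u (\<one>, \<one>\<^bsub>M\<^esub>))"])
    fix x v assume x: "x \<in> X" and v: "v \<in> carrier G"
    show "snd (\<theta> (x \<otimes> v) (\<one>, \<one>\<^bsub>M\<^esub>)) = g x v \<otimes>\<^bsub>M\<^esub> snd (\<theta> v (\<one>, \<one>\<^bsub>M\<^esub>))"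
      using x v \<theta>m[OF _ _ one, of x v] \<theta>S[OF _ one, of v] fst[OF v] by (simp add: \<theta>(2) b_def)
  next
    fix v assume "v \<in> carrier G"
    then show "snd (\<theta> v (\<one>, \<one>\<^bsub>M\<^esub>)) \<in> carrier M"
      using \<theta>S[OF _ one, of v] by (auto simp: S_def)
  qed (simp add: \<theta>1 one)
qed

lemma exists_int_cocycle:
  fixes g :: "'a \<Rightarrow> 'a \<Rightarrow> int"
  obtains R where "R \<one> = 0" "\<And>x v. x \<in> X \<Longrightarrow> v \<in> carrier G \<Longrightarrow> R (x \<otimes> v) = g x v + R v"
proof -
  obtain R where "R \<one> = \<one>\<^bsub>integer_group\<^esub>"
    "\<And>x v. x \<in> X \<Longrightarrow> v \<in> carrier G \<Longrightarrow> R (x \<otimes> v) = g x v \<otimes>\<^bsub>integer_group\<^esub> R v"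
    using exists_cocycle[OF group_integer_group, of g] by (metis UNIV_I carrier_integer_group)
  then show ?thesis by (intro that[of R]) auto
qed

end

section \<open>Polynomial functions modulo an integer\<close>

text \<open>
  Both left and right differences lower the degree, so that left-invariant functions can be
  handled by right differences.
\<close>

primrec poly_fun :: "('a, 'b) monoid_scheme \<Rightarrow> int \<Rightarrow> nat \<Rightarrow> ('a \<Rightarrow> int) \<Rightarrow> bool" where
  "poly_fun G p 0 f \<longleftrightarrow> (\<forall>u \<in> carrier G. \<forall>v \<in> carrier G. [f u = f v] (mod p))"
| "poly_fun G p (Suc d) f \<longleftrightarrow>
     (\<forall>u \<in> carrier G. poly_fun G p d (\<lambda>v. f (u \<otimes>\<^bsub>G\<^esub> v) - f v) \<and>
                      poly_fun G p d (\<lambda>v. f (v \<otimes>\<^bsub>G\<^esub> u) - f v))"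

context group
begin

lemma poly_fun_cong:
  assumes "poly_fun G p d f" "\<And>v. v \<in> carrier G \<Longrightarrow> [g v = f v] (mod p)"
  shows "poly_fun G p d g"
  using assms
proof (induction d arbitrary: f g)
  case 0
  then show ?case unfolding poly_fun.simps by (meson cong_sym cong_trans)
next
  case (Suc d)
  have f: "poly_fun G p d (\<lambda>v. f (u \<otimes> v) - f v)" "poly_fun G p d (\<lambda>v. f (v \<otimes> u) - f v)"
    if "u \<in> carrier G" for u
    using Suc.prems(1) that by simp_all
  show ?case unfolding poly_fun.simps
    by (intro ballI conjI, rule Suc.IH[OF f(1)], assumption, intro cong_diff Suc.prems(2) m_closed,
        assumption+, rule Suc.IH[OF f(2)], assumption, intro cong_diff Suc.prems(2) m_closed)
qed

lemma poly_fun_add: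
  assumes "poly_fun G p d f" "poly_fun G p d g"
  shows "poly_fun G p d (\<lambda>v. f v + g v)"
  using assms
proof (induction d arbitrary: f g)
  case 0
  then show ?case unfolding poly_fun.simps by (blast intro: cong_add)
next
  case (Suc d)
  have eq: "(f a + g a) - (f b + g b) = (f a - f b) + (g a - g b)" for a b by simp
  show ?case unfolding poly_fun.simps eq
    using Suc.prems by (intro ballI conjI Suc.IH) simp_all
qed

lemma poly_fun_uminus:
  assumes "poly_fun G p d f"
  shows "poly_fun G p d (\<lambda>v. - f v)"
  using assms
proof (induction d arbitrary: f)
  case 0
  then show ?case by (simp add: cong_minus_minus_iff)
next
  case (Suc d)
  have eq: "- f a - - f b = - (f a - f b)" for a b by simp
  show ?case unfolding poly_fun.simps eq
    using Suc.prems by (intro ballI conjI Suc.IH) simp_all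
qed

lemma poly_fun_diff:
  assumes "poly_fun G p d f" "poly_fun G p d g"
  shows "poly_fun G p d (\<lambda>v. f v - g v)"
  using poly_fun_add[OF assms(1) poly_fun_uminus[OF assms(2)]] by simp

lemma poly_fun_const: "poly_fun G p d (\<lambda>_. c)"
  by (induction d arbitrary: c) auto

lemma poly_fun_Suc: "poly_fun G p d f \<Longrightarrow> poly_fun G p (Suc d) f"
proof (induction d arbitrary: f)
  case 0
  then show ?case by (auto intro!: cong_diff)
next
  case (Suc d)
  then have f: "poly_fun G p d (\<lambda>v. f (u \<otimes> v) - f v)" "poly_fun G p d (\<lambda>v. f (v \<otimes> u) - f v)"
    if "u \<in> carrier G" for u
    using that by simp_all
  show ?case
    by (subst poly_fun.simps) (intro ballI conjI Suc.IH f)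
qed

lemma poly_fun_translate:
  assumes "poly_fun G p d f" "u \<in> carrier G"
  shows "poly_fun G p d (\<lambda>v. f (u \<otimes> v))" "poly_fun G p d (\<lambda>v. f (v \<otimes> u))"
proof -
  have "poly_fun G p d (\<lambda>v. f (u \<otimes> v) - f v)" "poly_fun G p d (\<lambda>v. f (v \<otimes> u) - f v)"
    using poly_fun_Suc[OF assms(1)] assms(2) by auto
  from this[THEN poly_fun_add, OF assms(1)]
  show "poly_fun G p d (\<lambda>v. f (u \<otimes> v))" "poly_fun G p d (\<lambda>v. f (v \<otimes> u))" by simp_all
qed

lemma poly_fun_hom:
  assumes "\<phi> \<in> hom G G" "poly_fun G p d f"
  shows "poly_fun G p d (\<lambda>v. f (\<phi> v))"
  using assms(2)
proof (induction d arbitrary: f)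
  case 0
  then show ?case using hom_in_carrier[OF assms(1)] by auto
next
  case (Suc d)
  show ?case unfolding poly_fun.simps
  proof (intro ballI conjI)
    fix u assume u: "u \<in> carrier G"
    then have "\<phi> u \<in> carrier G" using hom_in_carrier[OF assms(1)] by auto
    then have "poly_fun G p d (\<lambda>v. f (\<phi> u \<otimes> \<phi> v) - f (\<phi> v))"
      "poly_fun G p d (\<lambda>v. f (\<phi> v \<otimes> \<phi> u) - f (\<phi> v))"
      using Suc.prems Suc.IH[of "\<lambda>v. f (\<phi> u \<otimes> v) - f v"] Suc.IH[of "\<lambda>v. f (v \<otimes> \<phi> u) - f v"]
      by auto
    from this[THEN poly_fun_cong]
    show "poly_fun G p d (\<lambda>v. f (\<phi> (u \<otimes> v)) - f (\<phi> v))"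
      "poly_fun G p d (\<lambda>v. f (\<phi> (v \<otimes> u)) - f (\<phi> v))"
      using u by (simp_all add: hom_mult[OF assms(1)])
  qed
qed

section \<open>Polynomial functions on the image of an endomorphism\<close>

definition hom_mod :: "int \<Rightarrow> ('a \<Rightarrow> int) \<Rightarrow> bool" where
  "hom_mod p l \<longleftrightarrow> (\<forall>u \<in> carrier G. \<forall>v \<in> carrier G. [l (u \<otimes> v) = l u + l v] (mod p))"

text \<open>
  For prime \<open>p\<close> and \<open>\<phi>\<close> an endomorphism: the image of \<open>\<phi>\<close> is dense in the pro-\<open>p\<close> topology.
\<close>

definition frattini_dense :: "int \<Rightarrow> ('a \<Rightarrow> 'a) \<Rightarrow> bool" where
  "frattini_dense p \<phi> \<longleftrightarrow> (\<forall>l. hom_mod p l \<longrightarrow> (\<forall>u \<in> carrier G. [l (\<phi> u) = 0] (mod p)) \<longrightarrow>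
     (\<forall>u \<in> carrier G. [l u = 0] (mod p)))"

text \<open>Right differences of \<open>f\<close> inherit the invariance and have lower degree, so
  they are constant by induction. Hence \<open>\<lambda>v. f v - f \<one>\<close> is a homomorphism
  modulo \<open>p\<close>. Invariance makes it vanish on the image of \<open>\<phi>\<close>, and
  density makes it vanish everywhere.\<close>

lemma poly_fun_left_invariant:
  assumes dense: "frattini_dense p \<phi>" and \<phi>: "\<phi> \<in> hom G G" and "poly_fun G p d f"
    and "\<And>u v. u \<in> carrier G \<Longrightarrow> v \<in> carrier G \<Longrightarrow> [f (\<phi> u \<otimes> v) = f v] (mod p)"
  shows "poly_fun G p 0 f"
  using assms(3,4)
proof (induction d arbitrary: f)
  case 0
  then show ?case by blast
next
  case (Suc d)
  have \<phi>c: "\<phi> u \<in> carrier G" if "u \<in> carrier G" for u using hom_in_carrier[OF \<phi> that] .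
  have inv: "[f (\<phi> u \<otimes> v) = f v] (mod p)" if "u \<in> carrier G" "v \<in> carrier G" for u v
    using Suc.prems that by blast
  have *: "[f (v \<otimes> u) - f v = f u - f \<one>] (mod p)" if u: "u \<in> carrier G" and v: "v \<in> carrier G" for u v
  proof -
    have "poly_fun G p 0 (\<lambda>v. f (v \<otimes> u) - f v)"
    proof (rule Suc.IH)
      fix a b assume a: "a \<in> carrier G" and b: "b \<in> carrier G"
      show "[f (\<phi> a \<otimes> b \<otimes> u) - f (\<phi> a \<otimes> b) = f (b \<otimes> u) - f b] (mod p)"
        using a b u \<phi>c inv[of a "b \<otimes> u"] inv[of a b] by (simp add: m_assoc cong_diff)
    qed (use Suc.prems u in auto)
    then have "[f (v \<otimes> u) - f v = f (\<one> \<otimes> u) - f \<one>] (mod p)"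
      using v unfolding poly_fun.simps by blast
    then show ?thesis using u by simp
  qed
  have "hom_mod p (\<lambda>v. f v - f \<one>)"
    unfolding hom_mod_def
  proof (intro ballI)
    fix u v assume "u \<in> carrier G" "v \<in> carrier G"
    then have "[(f (u \<otimes> v) - f u) + (f u - f \<one>) = (f v - f \<one>) + (f u - f \<one>)] (mod p)"
      by (intro cong_add *) auto
    then show "[f (u \<otimes> v) - f \<one> = f u - f \<one> + (f v - f \<one>)] (mod p)"
      by (simp add: algebra_simps)
  qed
  moreover have "[f (\<phi> u) - f \<one> = 0] (mod p)" if "u \<in> carrier G" for u
    using inv[OF that, of \<one>] that \<phi>c by (simp add: cong_diff_iff_cong_0)
  ultimately have "[f u - f \<one> = 0] (mod p)" if "u \<in> carrier G" for u
    using dense that unfolding frattini_dense_def by blast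
  then have "[f u = f \<one>] (mod p)" if "u \<in> carrier G" for u
    using that by (simp add: cong_diff_iff_cong_0)
  then show ?case unfolding poly_fun.simps by (meson cong_sym cong_trans)
qed

text \<open>The left difference of \<open>f\<close> along \<open>\<phi> a\<close> vanishes on the
  image of \<open>\<phi>\<close> and has lower degree, so it vanishes everywhere by induction. Thus
  \<open>f\<close> is left invariant under the image, hence constant.\<close>

lemma poly_fun_zero:
  assumes dense: "frattini_dense p \<phi>" and \<phi>: "\<phi> \<in> hom G G" and "poly_fun G p d f"
    and "\<And>u. u \<in> carrier G \<Longrightarrow> [f (\<phi> u) = 0] (mod p)" and "u \<in> carrier G"
  shows "[f u = 0] (mod p)"
  using assms(3-)
proof (induction d arbitrary: f u)
  case 0
  then have "[f u = f (\<phi> \<one>)] (mod p)" using hom_in_carrier[OF \<phi>] by simp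
  then show ?case using 0(2)[of \<one>] by (meson cong_trans one_closed)
next
  case (Suc d)
  have \<phi>c: "\<phi> u \<in> carrier G" if "u \<in> carrier G" for u using hom_in_carrier[OF \<phi> that] .
  have inv: "[f (\<phi> a \<otimes> v) = f v] (mod p)" if a: "a \<in> carrier G" and v: "v \<in> carrier G" for a v
  proof -
    have "[f (\<phi> a \<otimes> v) - f v = 0] (mod p)"
    proof (rule Suc.IH[of "\<lambda>v. f (\<phi> a \<otimes> v) - f v"])
      fix b assume b: "b \<in> carrier G"
      show "[f (\<phi> a \<otimes> \<phi> b) - f (\<phi> b) = 0] (mod p)"
        using Suc.prems(2)[of "a \<otimes> b"] Suc.prems(2)[of b] a b cong_diff
        by (fastforce simp: hom_mult[OF \<phi>])
    qed (use Suc.prems \<phi>c a v in auto)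
    then show ?thesis by (simp add: cong_diff_iff_cong_0)
  qed
  have "poly_fun G p 0 f"
    by (rule poly_fun_left_invariant[OF dense \<phi> Suc.prems(1) inv])
  then have "[f u = f (\<phi> \<one>)] (mod p)" using Suc.prems \<phi>c by simp
  then show ?case using Suc.prems(2)[of \<one>] by (meson cong_trans one_closed)
qed

end

section \<open>Polynomial functions on free groups\<close>

context free_group_basis
begin

lemma poly_fun_left_differences:
  assumes f: "\<And>x. x \<in> X \<Longrightarrow> poly_fun G p d (\<lambda>v. f (x \<otimes> v) - f v)" and u: "u \<in> carrier G"
  shows "poly_fun G p d (\<lambda>v. f (u \<otimes> v) - f v)"
  using u
proof (induction rule: free_induct)
  case one
  show ?case by (rule poly_fun_cong[OF poly_fun_const[of _ _ 0]]) simp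
next
  case (gen x u)
  show ?case
    by (rule poly_fun_cong[OF poly_fun_add[OF poly_fun_translate(1)[OF f[OF gen(1)] gen(2)] gen(3)]])
      (use gen in \<open>simp add: m_assoc\<close>)
next
  case (inv x u)
  have c: "inv x \<otimes> u \<in> carrier G" using inv by simp
  have "x \<otimes> (inv x \<otimes> u \<otimes> v) = u \<otimes> v" if "v \<in> carrier G" for v
    using inv that by (simp flip: m_assoc)
  then show ?case
    by (intro poly_fun_cong[OF poly_fun_diff[OF inv(3) poly_fun_translate(1)[OF f[OF inv(1)] c]]]) simp
qed

text \<open>Left and right multiplication commute, so if the left differences along the basis are
  constant, the right difference along \<open>u\<close> does not change when a letter is put in
  front of its argument. This is the base case of \<open>poly_fun_integral\<close>.\<close>

lemma poly_fun_0_right_differences: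
  assumes f: "\<And>x. x \<in> X \<Longrightarrow> poly_fun G p 0 (\<lambda>v. f (x \<otimes> v) - f v)" and u: "u \<in> carrier G"
  shows "poly_fun G p 0 (\<lambda>v. f (v \<otimes> u) - f v)"
proof -
  let ?e = "\<lambda>v. f (v \<otimes> u) - f v"
  have e: "[?e (x \<otimes> v) = ?e v] (mod p)" if x: "x \<in> X" and v: "v \<in> carrier G" for x v
  proof -
    have "[f (x \<otimes> (v \<otimes> u)) - f (v \<otimes> u) = f (x \<otimes> v) - f v] (mod p)"
      using f[OF x] u v by simp
    then have "[(f (x \<otimes> (v \<otimes> u)) - f (v \<otimes> u)) + (f (v \<otimes> u) - f (x \<otimes> v))
        = (f (x \<otimes> v) - f v) + (f (v \<otimes> u) - f (x \<otimes> v))] (mod p)"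
      by (rule cong_add) simp
    then show ?thesis using x u v by (simp add: m_assoc)
  qed
  have "[?e v = ?e \<one>] (mod p)" if "v \<in> carrier G" for v
    using that
  proof (induction rule: free_induct)
    case (gen x v)
    then show ?case using e[of x v] by (meson cong_trans)
  next
    case (inv x v)
    then have "x \<otimes> (inv x \<otimes> v) = v" by (simp flip: m_assoc)
    then have "[?e v = ?e (inv x \<otimes> v)] (mod p)"
      using inv e[of x "inv x \<otimes> v"] by simp
    then show ?case using inv(3) by (rule cong_trans[OF cong_sym])
  qed simp
  then show ?thesis
    unfolding poly_fun.simps by (meson cong_sym cong_trans)
qed

text \<open>This makes functions defined by recursion on letters accessible to
  \<open>poly_fun\<close>. Right differences of \<open>f\<close> satisfy the hypothesis one degree
  lower, because left and right differences commute.\<close>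

lemma poly_fun_integral:
  assumes "\<And>x. x \<in> X \<Longrightarrow> poly_fun G p d (\<lambda>v. f (x \<otimes> v) - f v)"
  shows "poly_fun G p (Suc d) f"
  using assms
proof (induction d arbitrary: f)
  case 0
  then show ?case
    using poly_fun_left_differences[of p 0 f] poly_fun_0_right_differences[of p f]
    unfolding poly_fun.simps(2) by blast
next
  case (Suc d)
  have "poly_fun G p (Suc d) (\<lambda>v. f (v \<otimes> u) - f v)" if u: "u \<in> carrier G" for u
  proof (rule Suc.IH)
    fix x assume x: "x \<in> X"
    have "poly_fun G p d (\<lambda>v. (f (x \<otimes> (v \<otimes> u)) - f (v \<otimes> u)) - (f (x \<otimes> v) - f v))"
      using Suc.prems[OF x] u by simp
    then show "poly_fun G p d (\<lambda>v. (f (x \<otimes> v \<otimes> u) - f (x \<otimes> v)) - (f (v \<otimes> u) - f v))"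
      by (rule poly_fun_cong) (use x u in \<open>simp add: m_assoc algebra_simps\<close>)
  qed
  with Suc.prems show ?case
    using poly_fun_left_differences[of p "Suc d" f]
    by (subst poly_fun.simps(2)) blast
qed

text \<open>
  \<open>f\<close> is obtained by integrating successively along the letters of the word. Reducedness ensures
  that the contribution \<open>- g (x \<otimes> v)\<close> of an inverse letter vanishes on proper suffixes.
\<close>

lemma exists_separating_poly_fun:
  assumes "fst ` set w \<subseteq> X" "reduced_word w"
  shows "\<exists>d f. poly_fun G p d f \<and> f (word_value G w) = 1 \<and>
           (\<forall>v. strict_suffix v w \<longrightarrow> f (word_value G v) = 0)"
  using assms
proof (induction w)
  case Nil
  show ?case
    by (intro exI[of _ 0] exI[of _ "\<lambda>_. 1"]) simp
next
  case (Cons y w)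
  obtain x b where y: "y = (x, b)" by force
  have x: "x \<in> X" and wX: "fst ` set w \<subseteq> X" using Cons.prems y by auto
  have red: "reduced_word w"
    using Cons.prems(2) by (cases w) (auto simp: reduced_word_def)
  obtain d g where g: "poly_fun G p d g" "g (word_value G w) = 1"
    "\<And>v. strict_suffix v w \<Longrightarrow> g (word_value G v) = 0"
    using Cons.IH[OF wX red] by blast
  \<comment> \<open>For \<open>b = False\<close> the rule at \<open>inv x \<otimes> v\<close> reads
    \<open>f (inv x \<otimes> v) = f v + g v\<close>. So for both signs, putting the letter
    \<open>y\<close> in front of a word adds the value of \<open>g\<close> at the shorter
    word.\<close>
  obtain f where f1: "f \<one> = 0" and f: "\<And>z v. z \<in> X \<Longrightarrow> v \<in> carrier G \<Longrightarrow>
      f (z \<otimes> v) = (if z = x then if b then g v else - g (x \<otimes> v) else 0) + f v"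
    using exists_int_cocycle[of "\<lambda>z v. if z = x then if b then g v else - g (x \<otimes> v) else 0"]
    by blast
  have "poly_fun G p d (\<lambda>v. f (z \<otimes> v) - f v)" if z: "z \<in> X" for z
  proof -
    have "poly_fun G p d (\<lambda>v. if z = x then if b then g v else - g (x \<otimes> v) else 0)"
      using g(1) x poly_fun_uminus[OF poly_fun_translate(1)[OF g(1), of x]]
      by (cases "z = x"; cases b) (simp_all add: poly_fun_const)
    then show ?thesis by (rule poly_fun_cong) (simp add: f z)
  qed
  then have pf: "poly_fun G p (Suc d) f" by (rule poly_fun_integral)
  have wc: "word_value G v \<in> carrier G" if "fst ` set v \<subseteq> X" for v
    using that basis_closed by (intro word_value_closed is_group) auto
  have step: "f (word_value G (y' # v)) = f (word_value G v) +
      (if y' = y then g (word_value G v)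
       else if y' = (x, \<not> b) then - g (word_value G (y' # v)) else 0)"
    if "fst y' \<in> X" "fst ` set v \<subseteq> X" for y' v
  proof -
    obtain z c where y': "y' = (z, c)" by force
    have z: "z \<in> X" using that y' by simp
    have inv: "z \<otimes> (inv z \<otimes> word_value G v) = word_value G v"
      using z wc[OF that(2)] by (simp flip: m_assoc)
    show ?thesis
      using inv f[OF z wc[OF that(2)]] f[OF z, of "inv z \<otimes> word_value G v"] z wc[OF that(2)]
      by (cases b; cases c) (auto simp: y y' word_value_simps)
  qed
  have zero: "f (word_value G v) = 0" if "suffix v w" for v
    using that
  proof (induction v)
    case Nil
    then show ?case by (simp add: word_value_simps f1)
  next
    case (Cons y' v)
    have v: "strict_suffix v w" using Cons.prems by (auto simp: strict_suffix_def suffix_def)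
    have sub: "set (y' # v) \<subseteq> set w" using Cons.prems by (rule set_mono_suffix)
    have "g (word_value G (y' # v)) = 0" if "y' = (x, \<not> b)"
    proof (rule g(3))
      \<comment> \<open>Otherwise \<open>y # w\<close> would begin with two cancelling
        letters.\<close>
      have "y' # v \<noteq> w"
        using that Cons.prems \<open>reduced_word (y # w)\<close> by (auto simp: reduced_word_def y)
      then show "strict_suffix (y' # v) w" using Cons.prems by (simp add: strict_suffix_def)
    qed
    moreover have "f (word_value G v) = 0"
      using Cons v by (simp add: strict_suffix_def)
    moreover have "fst y' \<in> X" "fst ` set v \<subseteq> X" using sub wX by auto
    ultimately show ?case
      using step[of y' v] g(3)[OF v] by auto
  qed
  show ?case
  proof (intro exI conjI allI impI)
    show "f (word_value G (y # w)) = 1"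
      using step[of y w] x wX zero[of w] g(2) by (simp add: y)
    fix v assume "strict_suffix v (y # w)"
    then show "f (word_value G v) = 0"
      by (intro zero) (auto simp: strict_suffix_def suffix_Cons)
  qed (rule pf)
qed

text \<open>A function separating the reduced word of \<open>u \<otimes> inv v\<close> from its
  proper suffixes has value 1 there and 0 at \<open>\<one>\<close>, the value of the empty suffix.
  Translation by \<open>inv v\<close> moves these two points to \<open>u\<close> and
  \<open>v\<close>.\<close>

lemma poly_fun_separates:
  assumes u: "u \<in> carrier G" and v: "v \<in> carrier G" and p: "p > 1"
    and eq: "\<And>d f. poly_fun G p d f \<Longrightarrow> [f u = f v] (mod p)"
  shows "u = v"
proof (rule ccontr)
  assume "u \<noteq> v"
  obtain w where w: "fst ` set w \<subseteq> X" "reduced_word w" "word_value G w = u \<otimes> inv v"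
    by (rule obtain_reduced_word[of "u \<otimes> inv v"]) (use u v in auto)
  obtain d f where f: "poly_fun G p d f" "f (u \<otimes> inv v) = 1"
    and 0: "\<And>z. strict_suffix z w \<Longrightarrow> f (word_value G z) = 0"
    using exists_separating_poly_fun[OF w(1,2), of p] w(3) by metis
  have "w \<noteq> []"
    using \<open>u \<noteq> v\<close> w(3) u v by (metis inv_closed inv_equality inv_inv word_value_simps(1))
  then have "f \<one> = 0" using 0[of "[]"] by (simp add: word_value_simps strict_suffix_def)
  moreover have "poly_fun G p d (\<lambda>z. f (z \<otimes> inv v))"
    using f(1) v by (intro poly_fun_translate) auto
  ultimately have "[1 = 0] (mod p)"
    using eq[of d "\<lambda>z. f (z \<otimes> inv v)"] f(2) v by simp
  then show False using p by (simp add: cong_def)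
qed

section \<open>Finiteness of polynomial functions and lifting along an endomorphism\<close>

definition normal_poly_funs :: "int \<Rightarrow> nat \<Rightarrow> ('a \<Rightarrow> int) set" where
  "normal_poly_funs p d = {f \<in> carrier G \<rightarrow>\<^sub>E {0..<p}. poly_fun G p d f}"

lemma normalize_poly_fun:
  assumes "p > 0" "poly_fun G p d f"
  shows "(\<lambda>v\<in>carrier G. f v mod p) \<in> normal_poly_funs p d"
  using assms poly_fun_cong[OF assms(2), of "\<lambda>v\<in>carrier G. f v mod p"]
  by (auto simp: normal_poly_funs_def cong_def)

lemma cong_if_differences_cong:
  fixes f f' :: "'a \<Rightarrow> int"
  assumes "[f \<one> = f' \<one>] (mod p)"
    and d: "\<And>x v. x \<in> X \<Longrightarrow> v \<in> carrier G \<Longrightarrow> [f (x \<otimes> v) - f v = f' (x \<otimes> v) - f' v] (mod p)"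
    and "v \<in> carrier G"
  shows "[f v = f' v] (mod p)"
  using assms(3)
proof (induction rule: free_induct)
  case (gen x v)
  then show ?case using cong_add[OF d[OF gen(1,2)] gen(3)] by (simp only: diff_add_cancel)
next
  case (inv x v)
  let ?v = "inv x \<otimes> v"
  have x: "x \<otimes> ?v = v" using inv by (simp flip: m_assoc)
  have "[f v - f ?v = f' v - f' ?v] (mod p)"
    using d[of x ?v] inv(1,2) x by simp
  from cong_diff[OF inv(3) this] show ?case by simp
qed (rule assms(1))

text \<open>A normalized function is determined by its value at \<open>\<one>\<close> and its
  differences along the finitely many basis elements, and these differences have lower
  degree.\<close>

lemma finite_normal_poly_funs:
  assumes X: "finite X" and p: "p > 0"
  shows "finite (normal_poly_funs p d)"
proof -
  have inj: "f = f'" if f: "f \<in> normal_poly_funs p d" "f' \<in> normal_poly_funs p d" "f \<one> = f' \<one>"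
    and d: "\<And>x v. x \<in> X \<Longrightarrow> v \<in> carrier G \<Longrightarrow> [f (x \<otimes> v) - f v = f' (x \<otimes> v) - f' v] (mod p)"
    for d f f'
  proof (rule PiE_ext[of f "carrier G" "\<lambda>_. {0..<p}" f'])
    show "f \<in> carrier G \<rightarrow>\<^sub>E {0..<p}" "f' \<in> carrier G \<rightarrow>\<^sub>E {0..<p}"
      using f by (auto simp: normal_poly_funs_def)
    fix v assume v: "v \<in> carrier G"
    have "[f v = f' v] (mod p)"
      by (rule cong_if_differences_cong[OF _ d v]) (use f(3) in auto)
    moreover have "f v \<in> {0..<p}" "f' v \<in> {0..<p}"
      using f v by (auto simp: normal_poly_funs_def PiE_iff)
    ultimately show "f v = f' v" by (simp add: cong_def)
  qed
  have one: "f \<one> \<in> {0..<p}" if "f \<in> normal_poly_funs p d" for d f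
    using that by (auto simp: normal_poly_funs_def PiE_iff)
  show ?thesis
  proof (induction d)
    case 0
    have "inj_on (\<lambda>f. f \<one>) (normal_poly_funs p 0)"
    proof (rule inj_onI, rule inj)
      fix f f' x v
      assume f: "f \<in> normal_poly_funs p 0" "f' \<in> normal_poly_funs p 0" and "x \<in> X" "v \<in> carrier G"
      then have "[f (x \<otimes> v) - f v = 0] (mod p)" "[f' (x \<otimes> v) - f' v = 0] (mod p)"
        unfolding cong_diff_iff_cong_0 by (simp_all add: normal_poly_funs_def)
      then show "[f (x \<otimes> v) - f v = f' (x \<otimes> v) - f' v] (mod p)"
        by (meson cong_sym cong_trans)
    qed
    moreover have "finite ((\<lambda>f. f \<one>) ` normal_poly_funs p 0)"
      by (rule finite_subset[of _ "{0..<p}"]) (use one in auto)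
    ultimately show ?case by (rule finite_imageD[rotated])
  next
    case (Suc d)
    define D where "D = (\<lambda>f. \<lambda>x\<in>X. \<lambda>v\<in>carrier G. (f (x \<otimes> v) - f v) mod p)"
    have D: "D f \<in> X \<rightarrow>\<^sub>E normal_poly_funs p d" if "f \<in> normal_poly_funs p (Suc d)" for f
      unfolding D_def
      by (intro restrict_PiE_iff[THEN iffD2] ballI normalize_poly_fun[OF p])
        (use that in \<open>simp add: normal_poly_funs_def\<close>)
    have "inj_on (\<lambda>f. (f \<one>, D f)) (normal_poly_funs p (Suc d))"
    proof (rule inj_onI, rule inj)
      fix f f' x v
      assume "(f \<one>, D f) = (f' \<one>, D f')" and x: "x \<in> X" "v \<in> carrier G"
      then have "D f x v = D f' x v" by simp
      then show "[f (x \<otimes> v) - f v = f' (x \<otimes> v) - f' v] (mod p)"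
        using x by (simp add: D_def cong_def)
    qed auto
    moreover have "finite ((\<lambda>f. (f \<one>, D f)) ` normal_poly_funs p (Suc d))"
      by (rule finite_subset[of _ "{0..<p} \<times> (X \<rightarrow>\<^sub>E normal_poly_funs p d)"])
        (use one D Suc X in \<open>auto intro!: finite_PiE\<close>)
    ultimately show ?case by (rule finite_imageD[rotated])
  qed
qed

text \<open>By \<open>poly_fun_zero\<close>, composition with \<open>\<phi>\<close> is an injective
  self-map of the finite set \<open>normal_poly_funs p d\<close>, hence surjective;
  \<open>f'\<close> is a preimage of the normalized \<open>f\<close>.\<close>

lemma poly_fun_lift:
  assumes X: "finite X" and p: "p > 0" and \<phi>: "\<phi> \<in> hom G G" "frattini_dense p \<phi>"
    and f: "poly_fun G p d f"
  obtains f' where "poly_fun G p d f'" "\<And>v. v \<in> carrier G \<Longrightarrow> [f' (\<phi> v) = f v] (mod p)"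
proof -
  let ?A = "normal_poly_funs p d"
  define T where "T = (\<lambda>f. \<lambda>v\<in>carrier G. f (\<phi> v) mod p)"
  have \<phi>c: "\<phi> u \<in> carrier G" if "u \<in> carrier G" for u using hom_in_carrier[OF \<phi>(1) that] .
  have "T f \<in> ?A" if "f \<in> ?A" for f
    unfolding T_def using that
    by (intro normalize_poly_fun[OF p] poly_fun_hom[OF \<phi>(1)]) (simp add: normal_poly_funs_def)
  then have "T ` ?A \<subseteq> ?A" by blast
  moreover have "inj_on T ?A"
  proof (rule inj_onI)
    fix f g assume f: "f \<in> ?A" and g: "g \<in> ?A" and eq: "T f = T g"
    have pf: "poly_fun G p d (\<lambda>v. f v - g v)"
      using f g by (auto intro: poly_fun_diff simp: normal_poly_funs_def)
    have 0: "[f (\<phi> v) - g (\<phi> v) = 0] (mod p)" if "v \<in> carrier G" for v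
      using fun_cong[OF eq, of v] that unfolding cong_diff_iff_cong_0 by (simp add: T_def cong_def)
    show "f = g"
    proof (rule PiE_ext[of f "carrier G" "\<lambda>_. {0..<p}" g])
      show "f \<in> carrier G \<rightarrow>\<^sub>E {0..<p}" "g \<in> carrier G \<rightarrow>\<^sub>E {0..<p}"
        using f g by (auto simp: normal_poly_funs_def)
      fix v assume v: "v \<in> carrier G"
      have "[f v = g v] (mod p)"
        using poly_fun_zero[OF \<phi>(2,1) pf 0 v] by (simp add: cong_diff_iff_cong_0)
      moreover have "f v \<in> {0..<p}" "g v \<in> {0..<p}"
        using f g v by (auto simp: normal_poly_funs_def PiE_iff)
      ultimately show "f v = g v" by (simp add: cong_def)
    qed
  qed
  ultimately have "T ` ?A = ?A"
    using finite_normal_poly_funs[OF X p] by (intro endo_inj_surj)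
  then obtain f' where f': "f' \<in> ?A" "T f' = (\<lambda>v\<in>carrier G. f v mod p)"
    using normalize_poly_fun[OF p f] by (metis (no_types, lifting) imageE)
  have "[f' (\<phi> v) = f v] (mod p)" if "v \<in> carrier G" for v
    using fun_cong[OF f'(2), of v] that by (simp add: T_def cong_def)
  moreover have "poly_fun G p d f'" using f'(1) by (simp add: normal_poly_funs_def)
  ultimately show ?thesis by (rule that[rotated])
qed

text \<open>Modulo \<open>p\<close> every polynomial function factors through \<open>\<phi>\<close>,
  so none can distinguish two points with the same image, while together they separate
  points.\<close>

lemma frattini_dense_inj:
  assumes "finite X" "p > 1" "\<phi> \<in> hom G G" "frattini_dense p \<phi>"
  shows "inj_on \<phi> (carrier G)"
proof (rule inj_onI)
  fix u v assume u: "u \<in> carrier G" and v: "v \<in> carrier G" and eq: "\<phi> u = \<phi> v"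
  show "u = v"
  proof (rule poly_fun_separates[OF u v assms(2)])
    fix d f assume "poly_fun G p d f"
    from poly_fun_lift[OF assms(1) _ assms(3,4) this] assms(2)
    obtain f' where "\<And>v. v \<in> carrier G \<Longrightarrow> [f' (\<phi> v) = f v] (mod p)"
      by (metis less_trans zero_less_one)
    from this[OF u] this[OF v] show "[f u = f v] (mod p)"
      unfolding eq by (meson cong_sym cong_trans)
  qed
qed

end

context free_group_basis
begin

section \<open>Endomorphisms fixing an element\<close>

text \<open>
  The labels of the edges of a Schreier graph between cosets visited by the word \<open>w\<close>, read from
  right to left, relative to coset representatives that are suffixes of \<open>w\<close>.
\<close>

definition coset_steps :: "('a \<times> bool) list \<Rightarrow> 'a set" where
  "coset_steps w = (let Q = word_value G ` set (suffixes w) in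
     (\<lambda>(b, x, a). inv b \<otimes> x \<otimes> a) ` (Q \<times> X \<times> Q))"

lemma finite_coset_steps: "finite X \<Longrightarrow> finite (coset_steps w)"
  by (simp add: coset_steps_def Let_def)

text \<open>\<open>R u\<close> is the product of the edge labels along the path spelled by
  \<open>u\<close> from \<open>H\<close> in the Schreier graph of left cosets; edges with an
  endpoint not visited by \<open>w\<close> count as trivial. Elements of \<open>H\<close> spell
  loops, whence multiplicativity.\<close>

lemma exists_retraction:
  assumes H: "subgroup H G" and w: "fst ` set w \<subseteq> X" "word_value G w \<in> H"
  defines "L \<equiv> generate G (H \<inter> coset_steps w)"
  obtains R where "\<And>u. u \<in> carrier G \<Longrightarrow> R u \<in> L"
    "\<And>u v. u \<in> H \<Longrightarrow> v \<in> H \<Longrightarrow> R (u \<otimes> v) = R u \<otimes> R v"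
    "\<And>u. u \<in> L \<Longrightarrow> R u = u" "R (word_value G w) = word_value G w"
proof -
  interpret H: subgroup H G by fact
  define Q where "Q = word_value G ` set (suffixes w)"
  have Qc: "q \<in> carrier G" if "q \<in> Q" for q
  proof -
    obtain v where v: "q = word_value G v" "suffix v w" using \<open>q \<in> Q\<close> by (auto simp: Q_def)
    then have "fst ` set v \<subseteq> carrier G" using w(1) basis_closed set_mono_suffix[OF v(2)] by blast
    then show ?thesis using v(1) word_value_closed[OF is_group] by simp
  qed
  have Q1: "\<one> \<in> Q" unfolding Q_def by (rule image_eqI[of _ _ "[]"]) (simp_all add: word_value_simps)
  \<comment> \<open>The suffix values lying in the coset \<open>vH\<close>; there are none if the
    word does not visit it.\<close>
  define C where "C = (\<lambda>v. {q \<in> Q. inv v \<otimes> q \<in> H})"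
  \<comment> \<open>Representing the coset \<open>H\<close> by \<open>\<one>\<close> ensures that
    \<open>R\<close> fixes the value of \<open>w\<close> exactly, rather than up to a coset
    representative.\<close>
  define \<tau> where "\<tau> = (\<lambda>A. if \<one> \<in> A then \<one> else SOME q. q \<in> A)"
  define g where "g = (\<lambda>x v. if C v \<noteq> {} \<and> C (x \<otimes> v) \<noteq> {}
    then inv (\<tau> (C (x \<otimes> v))) \<otimes> x \<otimes> \<tau> (C v) else \<one>)"
  have \<tau>: "\<tau> A \<in> A" if "A \<noteq> {}" for A
    using that by (auto simp: \<tau>_def some_in_eq)
  have \<tau>C: "\<tau> (C v) \<in> Q" "\<tau> (C v) \<in> carrier G" "inv v \<otimes> \<tau> (C v) \<in> H" if "C v \<noteq> {}" for v
    using \<tau>[OF that] Qc by (auto simp: C_def)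
  \<comment> \<open>\<open>C\<close> depends only on the left coset, and therefore so does
    \<open>g x\<close>. This is what makes \<open>R\<close> multiplicative in
    \<open>RH\<close>.\<close>
  have CH: "C (v \<otimes> u) = C v" if "u \<in> H" "v \<in> carrier G" for u v
  proof -
    have "inv u \<otimes> (inv v \<otimes> q) \<in> H \<longleftrightarrow> inv v \<otimes> q \<in> H" if "q \<in> Q" for q
    proof
      assume "inv u \<otimes> (inv v \<otimes> q) \<in> H"
      then have "u \<otimes> (inv u \<otimes> (inv v \<otimes> q)) \<in> H" using \<open>u \<in> H\<close> by simp
      then show "inv v \<otimes> q \<in> H"
        using \<open>u \<in> H\<close> \<open>v \<in> carrier G\<close> Qc[OF that] by (simp flip: m_assoc)
    qed (use \<open>u \<in> H\<close> in simp)
    then show ?thesis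
      using that Qc by (auto simp: C_def inv_mult_group m_assoc)
  qed
  have CQ: "q \<in> C q" if "q \<in> Q" for q
    using that Qc by (simp add: C_def)
  have gB: "g x v \<in> H \<inter> coset_steps w \<or> g x v = \<one>" if x: "x \<in> X" and v: "v \<in> carrier G" for x v
  proof (cases "C v \<noteq> {} \<and> C (x \<otimes> v) \<noteq> {}")
    case True
    let ?a = "\<tau> (C v)" and ?b = "\<tau> (C (x \<otimes> v))"
    have "inv (inv (x \<otimes> v) \<otimes> ?b) \<otimes> (inv v \<otimes> ?a) \<in> H"
      using \<tau>C True by blast
    also have "inv (inv (x \<otimes> v) \<otimes> ?b) \<otimes> (inv v \<otimes> ?a) = inv ?b \<otimes> x \<otimes> (v \<otimes> inv v) \<otimes> ?a"
      using \<tau>C True x v by (simp add: inv_mult_group m_assoc del: r_inv Units_r_inv)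
    also have "\<dots> = g x v"
      using \<tau>C True x v by (simp add: g_def)
    finally have "g x v \<in> H" .
    moreover have "g x v \<in> coset_steps w"
      using True \<tau>C(1) x by (force simp: g_def coset_steps_def Let_def simp flip: Q_def)
    ultimately show ?thesis by simp
  qed (auto simp: g_def)
  have gc: "g x v \<in> carrier G" if "x \<in> X" "v \<in> carrier G" for x v
    using gB[OF that] H.subset by auto
  obtain R where Rc: "\<And>v. v \<in> carrier G \<Longrightarrow> R v \<in> carrier G" and R1: "R \<one> = \<one>"
    and R: "\<And>x v. x \<in> X \<Longrightarrow> v \<in> carrier G \<Longrightarrow> R (x \<otimes> v) = g x v \<otimes> R v"
    using exists_cocycle[OF is_group, of g] gc by metis
  have xv: "x \<otimes> (inv x \<otimes> v) = v" if "x \<in> X" "v \<in> carrier G" for x v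
    using that by (simp flip: m_assoc)
  have R': "R (inv x \<otimes> v) = inv (g x (inv x \<otimes> v)) \<otimes> R v" if "x \<in> X" "v \<in> carrier G" for x v
    using R[OF that(1), of "inv x \<otimes> v"] xv[OF that] that gc[OF that(1), of "inv x \<otimes> v"]
      Rc[of "inv x \<otimes> v"]
    by (simp flip: m_assoc)
  have L: "subgroup L G"
    unfolding L_def by (rule generate_is_subgroup) (use H.subset in blast)
  interpret L: subgroup L G by (rule L)
  have gL: "g x v \<in> L" if "x \<in> X" "v \<in> carrier G" for x v
    using gB[OF that] L.one_closed generate.incl unfolding L_def by metis
  have RL: "R u \<in> L" if "u \<in> carrier G" for u
    using that by (induction rule: free_induct) (auto simp: R1 R R' gL)
  have RH: "R (v \<otimes> u) = R v \<otimes> R u" if v: "v \<in> carrier G" and u: "u \<in> H" for u v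
    using v
  proof (induction rule: free_induct)
    case one
    then show ?case using u Rc by (simp add: R1)
  next
    case (gen x v)
    have "g x (v \<otimes> u) = g x v"
      using gen(1,2) u CH[OF u, of v] CH[OF u, of "x \<otimes> v"] by (simp add: g_def m_assoc)
    then show ?case
      using gen u Rc gc by (simp add: R m_assoc)
  next
    case (inv x v)
    have "g x (inv x \<otimes> v \<otimes> u) = g x (inv x \<otimes> v)"
      using inv(1,2) u CH[OF u, of "inv x \<otimes> v"] CH[OF u, of "x \<otimes> (inv x \<otimes> v)"]
      by (simp add: g_def m_assoc)
    then show ?case
      using inv u Rc gc R'[OF inv(1,2)] R'[OF inv(1), of "v \<otimes> u"] by (simp add: m_assoc)
  qed
  \<comment> \<open>All cosets along a suffix of \<open>w\<close> are visited, so the labels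
    telescope.\<close>
  have RQ': "R (word_value G v) = inv (\<tau> (C (word_value G v))) \<otimes> word_value G v" if "suffix v w" for v
    using that
  proof (induction v)
    case Nil
    have "\<one> \<in> C \<one>" using CQ[OF Q1] .
    then show ?case by (simp add: word_value_simps R1 \<tau>_def)
  next
    case (Cons y v)
    have sub: "suffix v w" using Cons.prems by (auto simp: suffix_def)
    let ?q = "word_value G v"
    obtain x b where y: "y = (x, b)" by force
    have x: "x \<in> X" using w(1) set_mono_suffix[OF Cons.prems] by (auto simp: y)
    have qQ: "?q \<in> Q" "word_value G (y # v) \<in> Q"
      using sub Cons.prems by (auto simp: Q_def)
    then have q: "?q \<in> carrier G" by (auto intro: Qc)
    have ne: "C ?q \<noteq> {}" "C (word_value G (y # v)) \<noteq> {}" using CQ qQ by blast+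
    note \<tau>c = \<tau>C(2)[OF ne(1)] \<tau>C(2)[OF ne(2)]
    have IH: "R ?q = inv (\<tau> (C ?q)) \<otimes> ?q" using Cons sub by simp
    have m: "a \<otimes> (inv a \<otimes> b) = b" "inv a \<otimes> (a \<otimes> b) = b"
      if "a \<in> carrier G" "b \<in> carrier G" for a b
      using that by (simp_all flip: m_assoc)
    show ?case
    proof (cases b)
      case True
      then show ?thesis
        using ne \<tau>c x q by (simp add: y word_value_simps R IH g_def m_assoc m)
    next
      case False
      then show ?thesis
        using ne \<tau>c x q R'[OF x q]
        by (simp add: y word_value_simps IH g_def m_assoc xv inv_mult_group m)
    qed
  qed
  have RQ: "R q = inv (\<tau> (C q)) \<otimes> q" if "q \<in> Q" for q
    using that RQ' by (auto simp: Q_def)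
  \<comment> \<open>Such a \<open>z\<close> satisfies \<open>b \<otimes> z = x \<otimes> a\<close>.
    Computing \<open>R\<close> of the two sides by \<open>RH\<close> and by the recursion gives
    \<open>R b \<otimes> R z = R b \<otimes> z\<close>.\<close>
  have R_step: "R z = z" if z: "z \<in> H \<inter> coset_steps w" for z
  proof -
    obtain a b x where ab: "a \<in> Q" "b \<in> Q" "x \<in> X" and zz: "z = inv b \<otimes> x \<otimes> a"
      using z by (auto simp: coset_steps_def Let_def simp flip: Q_def)
    have c: "a \<in> carrier G" "b \<in> carrier G" "x \<in> carrier G" using ab Qc by auto
    have bz: "b \<otimes> z = x \<otimes> a" using c by (simp add: zz flip: m_assoc)
    have Cb: "C (x \<otimes> a) = C b" using CH[of z b] z c by (simp add: bz)
    have ne: "C a \<noteq> {}" "C b \<noteq> {}" using CQ ab by blast+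
    have \<tau>c: "\<tau> (C a) \<in> carrier G" "\<tau> (C b) \<in> carrier G" using \<tau>C(2) ne by auto
    have "R b \<otimes> R z = R (x \<otimes> a)" using RH[of b z] z c by (simp add: bz)
    also have "\<dots> = inv (\<tau> (C b)) \<otimes> x \<otimes> (\<tau> (C a) \<otimes> inv (\<tau> (C a))) \<otimes> a"
      using R[OF ab(3) c(1)] RQ[OF ab(1)] ne \<tau>c c Cb
      by (simp add: g_def m_assoc del: r_inv Units_r_inv)
    also have "\<dots> = R b \<otimes> z"
      using RQ[OF ab(2)] \<tau>c c bz z H.subset by (simp add: m_assoc)
    finally have eq: "R b \<otimes> R z = R b \<otimes> z" .
    have "R b \<in> carrier G" "R z \<in> carrier G" "z \<in> carrier G"
      using Rc c(2) z H.subset by auto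
    then have "R z = inv (R b) \<otimes> (R b \<otimes> R z)" by (simp flip: m_assoc)
    also have "\<dots> = z"
      unfolding eq using \<open>R b \<in> carrier G\<close> \<open>z \<in> carrier G\<close> by (simp flip: m_assoc)
    finally show ?thesis .
  qed
  have LH: "L \<subseteq> H" unfolding L_def by (rule generate_subgroup_incl[OF _ H]) simp
  have R_id: "R u = u" if "u \<in> L" for u
    using that unfolding L_def
  proof (induction rule: generate.induct)
    case one
    show ?case by (rule R1)
  next
    case (incl z)
    then show ?case by (rule R_step)
  next
    case (inv z)
    then have z: "z \<in> H" "z \<in> carrier G" using H.subset by auto
    have "R (inv z \<otimes> z) = R (inv z) \<otimes> z"
      using RH[of "inv z" z] z R_step[OF inv] by simp
    then have "R (inv z) \<otimes> z = \<one>" using z by (simp add: R1)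
    then have "inv z = R (inv z)" by (rule inv_equality) (use z Rc in simp_all)
    then show ?case by simp
  next
    case (eng u v)
    then have "u \<in> H" "v \<in> H" using LH by (auto simp: L_def)
    then show ?case using eng RH[of u v] by simp
  qed
  have "\<one> \<in> C (word_value G w)"
    using w(2) Q1 by (simp add: C_def)
  moreover have "word_value G w \<in> Q" by (simp add: Q_def)
  ultimately have "R (word_value G w) = word_value G w"
    using RQ[of "word_value G w"] Qc by (simp add: \<tau>_def)
  then show ?thesis
    using RL RH R_id by (intro that[of R]) auto
qed

text \<open>Both \<open>\<phi>\<close> and its composition \<open>\<rho>\<close> with the retraction
  fix \<open>h\<close>, so density is available for both: lifting along \<open>\<phi>\<close> and
  testing on the image of \<open>\<rho>\<close> shows that the retraction is the identity on the
  image of \<open>\<phi>\<close>.\<close>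

lemma image_generated_by_coset_steps:
  assumes X: "finite X" and p: "p > 1" and \<phi>: "\<phi> \<in> hom G G" "\<phi> h = h"
    and dense: "\<And>\<psi>. \<psi> \<in> hom G G \<Longrightarrow> \<psi> h = h \<Longrightarrow> frattini_dense p \<psi>"
    and w: "fst ` set w \<subseteq> X" "word_value G w = h"
  shows "\<phi> ` carrier G = generate G (\<phi> ` carrier G \<inter> coset_steps w)"
proof -
  define H where "H = \<phi> ` carrier G"
  define L where "L = generate G (H \<inter> coset_steps w)"
  have \<phi>c: "\<phi> u \<in> carrier G" if "u \<in> carrier G" for u using hom_in_carrier[OF \<phi>(1) that] .
  have H: "subgroup H G"
    unfolding H_def using \<phi>(1)
    by (intro group_hom.img_is_subgroup) (simp add: group_hom_def group_hom_axioms_def)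
  have h: "h \<in> carrier G"
    using w basis_closed by (auto intro!: word_value_closed is_group)
  have "h \<in> H" unfolding H_def using \<phi>(2) h by (metis image_eqI)
  with exists_retraction[OF H w(1)] w(2) obtain R where
    RL: "\<And>u. u \<in> carrier G \<Longrightarrow> R u \<in> L" and
    RH: "\<And>u v. u \<in> H \<Longrightarrow> v \<in> H \<Longrightarrow> R (u \<otimes> v) = R u \<otimes> R v" and
    R: "\<And>u. u \<in> L \<Longrightarrow> R u = u" "R h = h"
    unfolding L_def by metis
  have LH: "L \<subseteq> H" unfolding L_def by (rule generate_subgroup_incl[OF _ H]) simp
  have HG: "H \<subseteq> carrier G" using H by (rule subgroup.subset)
  define \<rho> where "\<rho> = (\<lambda>v. R (\<phi> v))"
  have \<rho>: "\<rho> \<in> hom G G"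
  proof (rule homI)
    fix u v assume "u \<in> carrier G" "v \<in> carrier G"
    then show "\<rho> (u \<otimes> v) = \<rho> u \<otimes> \<rho> v"
      by (simp add: \<rho>_def hom_mult[OF \<phi>(1)] RH H_def)
  next
    fix u assume "u \<in> carrier G"
    then show "\<rho> u \<in> carrier G" using RL \<phi>c LH HG by (auto simp: \<rho>_def)
  qed
  have \<rho>h: "\<rho> h = h" by (simp add: \<rho>_def \<phi>(2) R(2))
  have "R (\<phi> u) = \<phi> u" if u: "u \<in> carrier G" for u
  proof (rule poly_fun_separates[OF _ _ p])
    show "R (\<phi> u) \<in> carrier G" "\<phi> u \<in> carrier G"
      using RL \<phi>c[OF u] LH HG by blast+
    fix d f assume f: "poly_fun G p d f"
    have "poly_fun G p d (\<lambda>v. f (\<rho> v))" by (rule poly_fun_hom[OF \<rho> f])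
    \<comment> \<open>If \<open>f'\<close> and \<open>f\<close> agree at \<open>\<phi> u\<close>,
      then \<open>f\<close> agrees at \<open>\<rho> u\<close> and \<open>\<phi> u\<close>. Agreement
      everywhere follows from agreement on the image of \<open>\<rho>\<close>.\<close>
    with X _ \<phi>(1) dense[OF \<phi>] obtain f' where f': "poly_fun G p d f'"
      "\<And>v. v \<in> carrier G \<Longrightarrow> [f' (\<phi> v) = f (\<rho> v)] (mod p)"
      by (rule poly_fun_lift) (use p in auto)
    have "[f' (\<rho> v) - f (\<rho> v) = 0] (mod p)" if v: "v \<in> carrier G" for v
    proof -
      have "\<rho> v \<in> L" using RL v \<phi>c by (simp add: \<rho>_def)
      then obtain v' where v': "v' \<in> carrier G" "\<rho> v = \<phi> v'" using LH by (auto simp: H_def)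
      \<comment> \<open>\<open>\<phi> v' = \<rho> v\<close> already lies in \<open>L\<close>, where
        \<open>R\<close> is the identity.\<close>
      have "\<rho> v' = \<rho> v" using R(1)[OF \<open>\<rho> v \<in> L\<close>] v'(2) by (simp add: \<rho>_def)
      then show ?thesis
        using f'(2)[OF v'(1)] v'(2) by (simp add: cong_diff_iff_cong_0)
    qed
    from poly_fun_zero[OF dense[OF \<rho> \<rho>h] \<rho> poly_fun_diff[OF f'(1) f] this \<phi>c[OF u]]
    have "[f' (\<phi> u) = f (\<phi> u)] (mod p)" by (simp add: cong_diff_iff_cong_0)
    with f'(2)[OF u] show "[f (R (\<phi> u)) = f (\<phi> u)] (mod p)"
      unfolding \<rho>_def by (meson cong_sym cong_trans)
  qed
  then have "H \<subseteq> L" using RL \<phi>c by (force simp: H_def)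
  then show ?thesis using LH by (simp add: L_def H_def)
qed

lemma test_element_if_frattini_dense:
  assumes X: "finite X" and p: "p > 1" and h: "h \<in> carrier G"
    and dense: "\<And>\<psi>. \<psi> \<in> hom G G \<Longrightarrow> \<psi> h = h \<Longrightarrow> frattini_dense p \<psi>"
  shows "test_element G h"
  unfolding test_element_def
proof (intro conjI ballI impI)
  fix \<phi> assume \<phi>: "\<phi> \<in> hom G G" "\<phi> h = h"
  have \<phi>c: "\<phi> u \<in> carrier G" if "u \<in> carrier G" for u using hom_in_carrier[OF \<phi>(1) that] .
  have pow: "(\<phi> ^^ k) \<in> hom G G" "(\<phi> ^^ k) h = h" for k
  proof (induction k)
    case 0
    case 1
    show ?case by (simp add: hom_def)
  next
    case (Suc k)
    case 1
    show ?case using Suc(1) \<phi>c by (auto simp: hom_def Pi_iff hom_mult[OF \<phi>(1)])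
  qed (simp_all add: \<phi>(2))
  have inj: "inj_on (\<phi> ^^ k) (carrier G)" for k
    by (intro frattini_dense_inj[OF X p] dense pow)
  obtain w where w: "fst ` set w \<subseteq> X" "word_value G w = h"
    using h by (rule obtain_reduced_word)
  define I where "I = (\<lambda>k. (\<phi> ^^ k) ` carrier G)"
  have I: "I k = generate G (I k \<inter> coset_steps w)" for k
    unfolding I_def by (rule image_generated_by_coset_steps[OF X p pow dense w])
  \<comment> \<open>The image of each power is determined by its intersection with one finite set,
    so two different powers share their image.\<close>
  have "finite (range (\<lambda>k. I k \<inter> coset_steps w))"
    by (rule finite_subset[of _ "Pow (coset_steps w)"]) (auto simp: finite_coset_steps[OF X])
  then have "\<not> inj (\<lambda>k. I k \<inter> coset_steps w)"
    using finite_imageD infinite_UNIV_nat by blast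
  then obtain k l where "k < l" "I k \<inter> coset_steps w = I l \<inter> coset_steps w"
    unfolding inj_def by (metis linorder_neqE_nat)
  then have kl: "k < l" "I k = I l" using I by metis+
  obtain j where j: "l = k + Suc j" using kl(1) less_iff_Suc_add by auto
  have "carrier G \<subseteq> \<phi> ` carrier G"
  proof
    fix u assume u: "u \<in> carrier G"
    then have "(\<phi> ^^ k) u \<in> I l" using kl(2) by (auto simp: I_def)
    then obtain v where v: "v \<in> carrier G" "(\<phi> ^^ k) u = (\<phi> ^^ k) ((\<phi> ^^ Suc j) v)"
      unfolding I_def j funpow_add by auto
    have c: "(\<phi> ^^ j) v \<in> carrier G" using hom_in_carrier[OF pow(1) v(1)] .
    \<comment> \<open>Injectivity cancels \<open>\<phi> ^^ k\<close>. The remaining exponent is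
      positive, so \<open>u\<close> is in the image of \<open>\<phi>\<close>.\<close>
    have "u = (\<phi> ^^ Suc j) v"
      using inj_onD[OF inj v(2)] u c \<phi>c by simp
    then show "u \<in> \<phi> ` carrier G" using c by simp
  qed
  then show "\<phi> \<in> iso G G"
    using \<phi>(1) \<phi>c inj[of 1] by (auto simp: iso_def bij_betw_def)
qed (rule h)

end

section \<open>The wreath product argument\<close>

lemma sum_indicator_dvd:
  fixes a c p :: int
  assumes "p > 0"
  shows "(\<Sum>s\<in>{0..<p}. if p dvd s + a then c else 0) = c"
proof -
  have "p dvd s + a \<longleftrightarrow> s = (- a) mod p" if "s \<in> {0..<p}" for s
  proof -
    have "p dvd s + a \<longleftrightarrow> s mod p = (- a) mod p" by (simp add: mod_eq_dvd_iff)
    then show ?thesis using that by simp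
  qed
  then have "(\<Sum>s\<in>{0..<p}. if p dvd s + a then c else 0) = (\<Sum>s\<in>{0..<p}. if s = (- a) mod p then c else 0)"
    by (intro sum.cong) auto
  also have "\<dots> = c" using assms by simp
  finally show ?thesis .
qed

text \<open>\<open>m\<close> is invertible modulo \<open>q\<close>, so \<open>q\<close> consecutive
  terms of the progression meet each residue class once.\<close>

lemma sum_arith_progression_cong:
  fixes F :: "int \<Rightarrow> int" and q :: nat
  assumes q: "prime q" and F: "\<And>s t. [s = t] (mod int q) \<Longrightarrow> F s = F t" and m: "\<not> int q dvd m"
  shows "(\<Sum>i<q. F (s + int i * m)) = (\<Sum>t\<in>{0..<int q}. F t)"
proof -
  have q0: "q > 0" using q prime_gt_0_nat by blast
  let ?f = "\<lambda>i. (s + int i * m) mod int q"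
  have inj: "inj_on ?f {..<q}"
  proof (rule inj_onI)
    fix i j assume ij: "i \<in> {..<q}" "j \<in> {..<q}" and "?f i = ?f j"
    then have "int q dvd (int i - int j) * m"
      by (simp add: mod_eq_dvd_iff algebra_simps)
    then have "int q dvd int i - int j"
      using m q prime_dvd_mult_iff[of "int q" "int i - int j" m] by simp
    then have "int i mod int q = int j mod int q" by (simp add: mod_eq_dvd_iff)
    then show "i = j" using ij by simp
  qed
  have "?f ` {..<q} = {0..<int q}"
    by (rule card_subset_eq) (use q0 in \<open>auto simp: card_image[OF inj]\<close>)
  with inj have bij: "bij_betw ?f {..<q} {0..<int q}" by (simp add: bij_betw_def)
  have "(\<Sum>t\<in>{0..<int q}. F t) = (\<Sum>i<q. F (?f i))"
    by (rule sum.reindex_bij_betw[OF bij, symmetric])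
  also have "\<dots> = (\<Sum>i<q. F (s + int i * m))"
    by (intro sum.cong refl F) (simp add: cong_def)
  finally show ?thesis by simp
qed

text \<open>
  The function \<open>T\<close> encodes a homomorphism into the wreath product of two cyclic groups of
  order \<open>p\<close>: it sends \<open>u\<close> to the pair of \<open>T u\<close> and \<open>\<mu> u\<close>.
\<close>

locale wreath_cocycle = group G for G :: "('a, 'b) monoid_scheme" (structure) +
  fixes q :: nat and l \<mu> :: "'a \<Rightarrow> int" and T :: "'a \<Rightarrow> int \<Rightarrow> int"
  assumes prime: "prime q"
    and \<mu>: "\<And>u v. u \<in> carrier G \<Longrightarrow> v \<in> carrier G \<Longrightarrow> \<mu> (u \<otimes> v) = \<mu> u + \<mu> v"
    and T: "\<And>u v s. u \<in> carrier G \<Longrightarrow> v \<in> carrier G \<Longrightarrow> T (u \<otimes> v) s = T u (s + \<mu> v) + T v s"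
    and periodic: "\<And>u s t. u \<in> carrier G \<Longrightarrow> [s = t] (mod int q) \<Longrightarrow> T u s = T u t"
    and total: "\<And>u. u \<in> carrier G \<Longrightarrow> [(\<Sum>s\<in>{0..<int q}. T u s) = l u] (mod int q)"
begin

lemma T_one: "T \<one> s = 0"
proof -
  have "\<mu> \<one> = 0" using \<mu>[of \<one> \<one>] by simp
  then show ?thesis using T[of \<one> \<one> s] by simp
qed

lemma T_pow: "z \<in> carrier G \<Longrightarrow> T (z [^] n) s = (\<Sum>i<n. T z (s + int i * \<mu> z))"
proof (induction n arbitrary: s)
  case 0
  then show ?case by (simp add: T_one)
next
  case (Suc n)
  then show ?case
    by (simp only: sum.lessThan_Suc_shift) (simp add: T algebra_simps)
qed

lemma \<mu>_pow: "z \<in> carrier G \<Longrightarrow> \<mu> (z [^] (n::nat)) = int n * \<mu> z"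
proof (induction n)
  case 0
  then show ?case using \<mu>[of \<one> \<one>] by simp
qed (simp add: \<mu> algebra_simps)

text \<open>By \<open>T_pow\<close> the value is a sum over \<open>q\<close> shifts by multiples of
  \<open>\<mu> z\<close>. If \<open>q\<close> divides \<open>\<mu> z\<close>, the terms are equal
  and the sum is a multiple of \<open>q\<close>; otherwise the shifts run through all residues and
  the sum is \<open>l z\<close> by \<open>total\<close>.\<close>

lemma T_pow_prime:
  assumes z: "z \<in> carrier G"
  shows "[T (z [^] q) s = (if int q dvd \<mu> z then 0 else l z)] (mod int q)"
proof (cases "int q dvd \<mu> z")
  case True
  have "T z (s + int i * \<mu> z) = T z s" for i
    by (rule periodic[OF z]) (use True in \<open>simp add: cong_iff_dvd_diff\<close>)
  then show ?thesis using True z by (simp add: T_pow cong_0_iff)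
next
  case False
  then show ?thesis
    using sum_arith_progression_cong[of q "T z" "\<mu> z" s] prime periodic[OF z] total[OF z]
    by (simp add: T_pow z)
qed

text \<open>\<open>q\<close> divides \<open>\<mu> (z [^] q)\<close>, so the second
  \<open>q\<close>-th power falls under the vanishing case of \<open>T_pow_prime\<close>. This is
  the exponent of the wreath product at work.\<close>

lemma T_pow_prime_square:
  assumes z: "z \<in> carrier G"
  shows "[T (((z [^] q) [^] q) [^] (k::nat)) s = 0] (mod int q)"
proof -
  have "[T ((z [^] q) [^] q) s = 0] (mod int q)" for s
    using T_pow_prime[of "z [^] q" s] z by (simp add: \<mu>_pow)
  then show ?thesis
    using z by (simp add: T_pow cong_0_iff dvd_sum)
qed

lemma T_mult_pow_prime_square:
  assumes "y \<in> carrier G" "z \<in> carrier G" "\<And>s. [T y s = c] (mod int q)"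
  shows "[T (y \<otimes> ((z [^] q) [^] q) [^] (k::nat)) s = c] (mod int q)"
  using cong_add[OF assms(3) T_pow_prime_square[OF assms(2)]] assms(1,2) by (simp add: T)

text \<open>Modulo \<open>q\<close>, the value of \<open>T\<close> at a \<open>q\<close>-th power
  does not depend on \<open>s\<close>. So the shift in the product rule has no effect and the values
  add up.\<close>

lemma T_prod_powers:
  assumes "a ` set xs \<subseteq> carrier G"
  shows "[T (foldr (\<lambda>x u. a x [^] q \<otimes> u) xs \<one>) s =
           (\<Sum>x\<leftarrow>xs. if int q dvd \<mu> (a x) then 0 else l (a x))] (mod int q)"
  using assms
proof (induction xs arbitrary: s)
  case Nil
  then show ?case by (simp add: T_one)
next
  case (Cons x xs)
  have c: "foldr (\<lambda>x u. a x [^] q \<otimes> u) xs \<one> \<in> carrier G"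
    using Cons.prems by (induction xs) auto
  have x: "a x \<in> carrier G" using Cons.prems by simp
  have "a ` set xs \<subseteq> carrier G" using Cons.prems by simp
  note IH = Cons.IH[OF this]
  show ?case
    using cong_add[OF T_pow_prime[OF x] IH] by (simp add: T c x)
qed

end

section \<open>Wreath product homomorphisms on a free group\<close>

context free_group_basis
begin

text \<open>\<open>\<mu>\<close> is the exponent sum of \<open>j\<close>, and \<open>T x\<close>
  takes the value \<open>l x\<close> at multiples of \<open>q\<close> and 0 elsewhere for basis
  elements \<open>x\<close>. Every \<open>s\<close> gives a separate integer cocycle
  \<open>T' s\<close>. Each further letter \<open>x\<close> contributes \<open>l x\<close> for
  exactly one \<open>s\<close> in \<open>{0..<int q}\<close>, which yields
  \<open>total\<close>.\<close>

lemma exists_wreath_cocycle: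
  assumes q: "prime q" and l: "hom_mod (int q) l" and j: "j \<in> X"
  obtains \<mu> T where "wreath_cocycle G q l \<mu> T" "\<And>x. x \<in> X \<Longrightarrow> \<mu> x = (if x = j then 1 else 0)"
proof -
  have q0: "int q > 0" using q prime_gt_0_nat by simp
  obtain \<mu> where \<mu>1: "\<mu> \<one> = (0::int)"
    and \<mu>x: "\<And>x v. x \<in> X \<Longrightarrow> v \<in> carrier G \<Longrightarrow> \<mu> (x \<otimes> v) = (if x = j then 1 else 0) + \<mu> v"
    using exists_int_cocycle[of "\<lambda>x v. if x = j then 1 else 0"] by blast
  have "\<exists>R. R \<one> = 0 \<and> (\<forall>x\<in>X. \<forall>v\<in>carrier G.
      R (x \<otimes> v) = (if int q dvd s + \<mu> v then l x else 0) + R v)" for s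
    by (rule exists_int_cocycle[of "\<lambda>x v. if int q dvd s + \<mu> v then l x else 0"]) blast
  then obtain T' where "\<forall>s. T' s \<one> = 0 \<and> (\<forall>x\<in>X. \<forall>v\<in>carrier G.
      T' s (x \<otimes> v) = (if int q dvd s + \<mu> v then l x else 0) + T' s v)"
    using choice[of "\<lambda>s R. R \<one> = 0 \<and> (\<forall>x\<in>X. \<forall>v\<in>carrier G.
      R (x \<otimes> v) = (if int q dvd s + \<mu> v then l x else 0) + R v)"] by blast
  then have T': "T' s \<one> = 0" "x \<in> X \<Longrightarrow> v \<in> carrier G \<Longrightarrow>
      T' s (x \<otimes> v) = (if int q dvd s + \<mu> v then l x else 0) + T' s v" for s x v
    by simp_all
  define T where "T = (\<lambda>u s. T' s u)"
  have T1: "T \<one> s = 0" for s by (simp add: T_def T')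
  have Tx: "T (x \<otimes> v) s = (if int q dvd s + \<mu> v then l x else 0) + T v s"
    if "x \<in> X" "v \<in> carrier G" for x v s
    using T'(2)[OF that] by (simp add: T_def)
  have xv: "x \<otimes> (inv x \<otimes> v) = v" if "x \<in> X" "v \<in> carrier G" for x v
    using that by (simp flip: m_assoc)
  have \<mu>: "\<mu> (u \<otimes> v) = \<mu> u + \<mu> v" if u: "u \<in> carrier G" and v: "v \<in> carrier G" for u v
    using u
  proof (induction rule: free_induct)
    case one
    then show ?case using v by (simp add: \<mu>1)
  next
    case (gen x u)
    then show ?case using v by (simp add: \<mu>x m_assoc)
  next
    case (inv x u)
    then show ?case
      using v \<mu>x[OF inv(1), of "inv x \<otimes> u"] \<mu>x[OF inv(1), of "inv x \<otimes> (u \<otimes> v)"]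
        xv[OF inv(1,2)] xv[OF inv(1), of "u \<otimes> v"]
      by (simp add: m_assoc)
  qed
  have T: "T (u \<otimes> v) s = T u (s + \<mu> v) + T v s"
    if u: "u \<in> carrier G" and v: "v \<in> carrier G" for u v s
    using u
  proof (induction rule: free_induct)
    case one
    then show ?case using v by (simp add: T1)
  next
    case (gen x u)
    then show ?case using v by (simp add: Tx \<mu> m_assoc algebra_simps)
  next
    case (inv x u)
    then show ?case
      using v Tx[OF inv(1), of "inv x \<otimes> u" "s + \<mu> v"] Tx[OF inv(1), of "inv x \<otimes> (u \<otimes> v)" s]
        xv[OF inv(1,2)] xv[OF inv(1), of "u \<otimes> v"] \<mu>[of "inv x \<otimes> u" v]
      by (simp add: m_assoc add.assoc add.commute[of "\<mu> v"])
  qed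
  have periodic: "T u s = T u t" if u: "u \<in> carrier G" and st: "[s = t] (mod int q)" for u s t
    using u
  proof (induction rule: free_induct)
    case one
    then show ?case by (simp add: T1)
  next
    case (gen x u)
    have "int q dvd s + \<mu> u \<longleftrightarrow> int q dvd t + \<mu> u"
      using st by (intro cong_dvd_iff cong_add) auto
    then show ?case using gen by (simp add: Tx)
  next
    case (inv x u)
    have "int q dvd s + \<mu> (inv x \<otimes> u) \<longleftrightarrow> int q dvd t + \<mu> (inv x \<otimes> u)"
      using st by (intro cong_dvd_iff cong_add) auto
    then show ?case
      using inv Tx[OF inv(1), of "inv x \<otimes> u" s] Tx[OF inv(1), of "inv x \<otimes> u" t] xv[OF inv(1,2)]
      by simp
  qed
  have sum: "(\<Sum>s\<in>{0..<int q}. T (x \<otimes> u) s) = l x + (\<Sum>s\<in>{0..<int q}. T u s)"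
    if "x \<in> X" "u \<in> carrier G" for x u
    using that by (simp add: Tx sum.distrib sum_indicator_dvd[OF q0])
  have l: "[l (u \<otimes> v) = l u + l v] (mod int q)" if "u \<in> carrier G" "v \<in> carrier G" for u v
    using l that by (simp add: hom_mod_def)
  have total: "[(\<Sum>s\<in>{0..<int q}. T u s) = l u] (mod int q)" if u: "u \<in> carrier G" for u
    using u
  proof (induction rule: free_induct)
    case one
    have "[l \<one> + l \<one> = l \<one> + 0] (mod int q)" using l[of \<one> \<one>] by (simp add: cong_sym)
    then have "[l \<one> = 0] (mod int q)" by (simp only: cong_add_lcancel)
    then show ?case by (simp add: T1 cong_sym)
  next
    case (gen x u)
    have "[l x + (\<Sum>s\<in>{0..<int q}. T u s) = l x + l u] (mod int q)"
      using gen(3) by (intro cong_add) auto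
    also have "[l x + l u = l (x \<otimes> u)] (mod int q)"
      using l[of x u] gen by (simp add: cong_sym)
    finally show ?case using sum[OF gen(1,2)] by simp
  next
    case (inv x u)
    have "[l x + (\<Sum>s\<in>{0..<int q}. T (inv x \<otimes> u) s) = l u] (mod int q)"
      using inv sum[OF inv(1), of "inv x \<otimes> u"] xv[OF inv(1,2)] by simp
    also have "[l u = l x + l (inv x \<otimes> u)] (mod int q)"
      using l[of x "inv x \<otimes> u"] inv xv[OF inv(1,2)] by simp
    finally show ?case by (simp only: cong_add_lcancel)
  qed
  have "wreath_cocycle G q l \<mu> T"
    by unfold_locales (fact q \<mu> T periodic total)+
  moreover have "\<mu> x = (if x = j then 1 else 0)" if "x \<in> X" for x
    using \<mu>x[OF that, of \<one>] that \<mu>1 by simp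
  ultimately show ?thesis by (rule that)
qed

lemma hom_mod_eq_0:
  assumes l: "hom_mod p l" and X: "\<And>x. x \<in> X \<Longrightarrow> [l x = 0] (mod p)" and u: "u \<in> carrier G"
  shows "[l u = 0] (mod p)"
proof -
  have l: "[l (u \<otimes> v) = l u + l v] (mod p)" if "u \<in> carrier G" "v \<in> carrier G" for u v
    using l that by (simp add: hom_mod_def)
  have gen: "[l (x \<otimes> v) = l v] (mod p)" if "x \<in> X" "v \<in> carrier G" for x v
    using cong_trans[OF l[of x v] cong_add[OF X[OF that(1)] cong_refl[of "l v"]]] that by simp
  show ?thesis
    using u
  proof (induction rule: free_induct)
    case one
    have "[l \<one> + l \<one> = l \<one> + 0] (mod p)" using l[of \<one> \<one>] by (simp add: cong_sym)
    then show ?case by (simp only: cong_add_lcancel)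
  next
    case (gen x v)
    then show ?case using \<open>\<And>x v. x \<in> X \<Longrightarrow> v \<in> carrier G \<Longrightarrow> [l (x \<otimes> v) = l v] (mod p)\<close>
      by (meson cong_trans)
  next
    case (inv x v)
    have "x \<otimes> (inv x \<otimes> v) = v" using inv by (simp flip: m_assoc)
    then have "[l v = l (inv x \<otimes> v)] (mod p)"
      using gen[OF inv(1), of "inv x \<otimes> v"] inv by simp
    then show ?case using inv(3) by (rule cong_trans[OF cong_sym])
  qed
qed

text \<open>For each basis element \<open>j\<close>, \<open>T h 0\<close> is computed modulo
  \<open>q\<close> in two ways: from the definition of \<open>h\<close> it is \<open>l j\<close>,
  and from \<open>h = \<phi> h\<close> it is 0, since \<open>l\<close> vanishes on the image of
  \<open>\<phi>\<close>. Hence \<open>l\<close> vanishes on the basis.\<close>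

lemma frattini_dense_fixing:
  assumes q: "prime q" and xs: "set xs = X" "distinct xs"
    and y: "y = foldr (\<lambda>x u. x [^] q \<otimes> u) xs \<one>" and z: "z \<in> carrier G"
    and h: "h = y \<otimes> ((z [^] q) [^] q) [^] (k::nat)" and \<phi>: "\<phi> \<in> hom G G" "\<phi> h = h"
  shows "frattini_dense (int q) \<phi>"
  unfolding frattini_dense_def
proof (intro allI impI ballI)
  fix l u
  assume l: "hom_mod (int q) l" and 0: "\<forall>u\<in>carrier G. [l (\<phi> u) = 0] (mod int q)"
    and u: "u \<in> carrier G"
  interpret \<phi>: group_hom G G \<phi>
    using \<phi>(1) by (simp add: group_hom_def group_hom_axioms_def)
  have fc: "foldr (\<lambda>x u. a x [^] q \<otimes> u) ys \<one> \<in> carrier G" if "a ` set ys \<subseteq> carrier G" for a ys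
    using that by (induction ys) auto
  have yc: "y \<in> carrier G" using fc[of "\<lambda>x. x" xs] basis_closed by (simp add: y xs)
  have "\<phi> (foldr (\<lambda>x u. x [^] q \<otimes> u) ys \<one>) = foldr (\<lambda>x u. \<phi> x [^] q \<otimes> u) ys \<one>"
    if "set ys \<subseteq> X" for ys
    using that
  proof (induction ys)
    case (Cons x ys)
    then have "x \<in> carrier G" "foldr (\<lambda>x u. x [^] q \<otimes> u) ys \<one> \<in> carrier G"
      using fc[of "\<lambda>x. x" ys] basis_closed by auto
    then show ?case using Cons by (simp add: \<phi>.hom_nat_pow)
  qed simp
  then have \<phi>y: "\<phi> y = foldr (\<lambda>x u. \<phi> x [^] q \<otimes> u) xs \<one>" by (simp add: y xs)
  have \<phi>h: "h = \<phi> y \<otimes> ((\<phi> z [^] q) [^] q) [^] k"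
    using \<phi>(2) yc z by (simp add: h \<phi>.hom_nat_pow)
  have "[l j = 0] (mod int q)" if j: "j \<in> X" for j
  proof -
    obtain \<mu> T where "wreath_cocycle G q l \<mu> T" and \<mu>x: "\<And>x. x \<in> X \<Longrightarrow> \<mu> x = (if x = j then 1 else 0)"
      using exists_wreath_cocycle[OF q l j] by metis
    then interpret W: wreath_cocycle G q l \<mu> T by simp
    have "\<not> int q dvd 1" using q by (simp add: prime_nat_iff)
    \<comment> \<open>Only \<open>x = j\<close> survives, as \<open>\<mu>\<close> is 1 at
      \<open>j\<close> and 0 at the other basis elements.\<close>
    then have "(\<Sum>x\<leftarrow>xs. if int q dvd \<mu> x then 0 else l x) = (\<Sum>x\<in>X. if x = j then l x else 0)"
      unfolding sum_list_distinct_conv_sum_set[OF xs(2)] xs(1)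
      by (intro sum.cong) (auto simp: \<mu>x)
    also have "\<dots> = l j" using j finite_set[of xs] unfolding xs(1) by simp
    finally have "[T y s = l j] (mod int q)" for s
      using W.T_prod_powers[of "\<lambda>x. x" xs s] basis_closed by (simp add: y xs)
    from W.T_mult_pow_prime_square[OF yc z this, of k 0]
    have 1: "[T h 0 = l j] (mod int q)" by (simp add: h)
    have "int q dvd (\<Sum>x\<leftarrow>ys. if int q dvd \<mu> (\<phi> x) then 0 else l (\<phi> x))" if "set ys \<subseteq> X" for ys
      using that 0 by (induction ys) (auto simp: cong_0_iff)
    from this[of xs]
    have "[(\<Sum>x\<leftarrow>xs. if int q dvd \<mu> (\<phi> x) then 0 else l (\<phi> x)) = 0] (mod int q)"
      by (simp add: cong_0_iff xs)
    moreover have "\<phi> ` set xs \<subseteq> carrier G" using xs basis_closed by auto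
    ultimately have "[T (\<phi> y) s = 0] (mod int q)" for s
      unfolding \<phi>y by (rule cong_trans[OF W.T_prod_powers, rotated])
    from W.T_mult_pow_prime_square[OF _ _ this, of "\<phi> z" k 0]
    have "[T h 0 = 0] (mod int q)" using yc z by (simp flip: \<phi>h)
    with 1 show ?thesis by (meson cong_sym cong_trans)
  qed
  then show "[l u = 0] (mod int q)" using hom_mod_eq_0[OF l _ u] by blast
qed

section \<open>Test elements in cosets of normal subgroups of finite index\<close>

lemma exists_test_element_in_coset:
  assumes X: "finite X" and N: "N \<lhd> G" "finite (rcosets N)" and g: "g \<in> carrier G"
  shows "\<exists>h \<in> g <# N. test_element G h"
proof -
  interpret N: normal N G by (rule N(1))
  interpret Q: group "G Mod N" by (rule N.factorgroup_is_group)
  define m where "m = order (G Mod N)"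
  have "m > 0"
    unfolding m_def using N(2) by (auto simp: order_def FactGroup_def card_gt_0_iff RCOSETS_def)
  have mN: "z [^] m \<in> N" if z: "z \<in> carrier G" for z
  proof -
    have "N #> z [^] m = (N #> z) [^]\<^bsub>G Mod N\<^esub> m"
      using hom_nat_pow[OF N.r_coset_hom_Mod z is_group N.factorgroup_is_group] by simp
    also have "\<dots> = \<one>\<^bsub>G Mod N\<^esub>"
      unfolding m_def by (rule Q.pow_order_eq_1) (use hom_in_carrier[OF N.r_coset_hom_Mod z] in simp)
    finally have "N #> z [^] m = N" by (simp add: FactGroup_def)
    then show ?thesis
      using rcos_self[OF nat_pow_closed[OF z] N.subgroup_axioms, of m] by simp
  qed
  \<comment> \<open>A prime larger than the index does not divide it, so \<open>m\<close> is
    invertible modulo \<open>q * q\<close>.\<close>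
  obtain q where q: "prime q" "q > m" using bigger_prime by blast
  have "\<not> q dvd m" using q(2) \<open>m > 0\<close> by (auto dest: dvd_imp_le)
  then have "coprime m (q * q)" using q(1) by (metis coprime_commute coprime_mult_right_iff prime_imp_coprime)
  then obtain c where "[m * c = Suc 0] (mod q * q)" by (meson cong_solve_coprime_nat)
  moreover have "q * q > 1" using prime_gt_1_nat[OF q(1)] by (metis less_1_mult)
  ultimately have "(m * c) mod (q * q) = 1" unfolding cong_def by (metis One_nat_def mod_less)
  then obtain k where k: "m * c = 1 + q * q * k" by (metis mult_div_mod_eq add.commute)
  obtain xs where xs: "set xs = X" "distinct xs" using finite_distinct_list[OF X] by blast
  define y where "y = foldr (\<lambda>x u. x [^] q \<otimes> u) xs \<one>"
  have "foldr (\<lambda>x u. x [^] q \<otimes> u) ys \<one> \<in> carrier G" if "set ys \<subseteq> X" for ys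
    using that by (induction ys) auto
  then have y: "y \<in> carrier G" using xs(1) by (simp add: y_def)
  define z where "z = inv g \<otimes> y"
  have z: "z \<in> carrier G" using g y by (simp add: z_def)
  \<comment> \<open>Divisibility of the exponent \<open>m * c\<close> by \<open>m\<close> puts the
    power of \<open>z\<close> into \<open>N\<close>. Since \<open>m * c = 1 + q * q * k\<close> and
    \<open>g \<otimes> z = y\<close>, the element \<open>h\<close> also equals \<open>y\<close>
    times a power of \<open>(z [^] q) [^] q\<close>.\<close>
  define h where "h = g \<otimes> z [^] (m * c)"
  have "z [^] (m * c) = z \<otimes> ((z [^] q) [^] q) [^] k"
    using nat_pow_mult[OF z, of 1 "q * q * k"] z by (simp add: k nat_pow_pow del: nat_pow_Suc)
  then have h: "h = y \<otimes> ((z [^] q) [^] q) [^] k"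
    unfolding h_def using g y by (simp add: z_def flip: m_assoc)
  have "z [^] (m * c) \<in> N"
    using mN[of "z [^] c"] z by (simp add: nat_pow_pow mult.commute)
  then have "h \<in> g <# N" by (auto simp: h_def l_coset_def)
  moreover have "test_element G h"
  proof (rule test_element_if_frattini_dense[OF X])
    show "int q > 1" using prime_gt_1_nat[OF q(1)] by simp
    show "h \<in> carrier G" using g z by (simp add: h_def)
  qed (rule frattini_dense_fixing[OF q(1) xs y_def z h])
  ultimately show ?thesis by blast
qed

end

theorem theorem7p5:
  fixes D :: "('a, 'b) monoid_scheme" and X :: "'a set"
  assumes "free_group_with_basis D X" and "finite X"
  shows "profinite_topology D closure_of {g. test_element D g}
           = topspace (profinite_topology D)"
proof -
  have D: "group D" using assms(1) by (simp add: free_group_with_basis_def)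
  interpret free_group_basis D X
    by (intro free_group_basis.intro free_group_basis_axioms.intro D assms(1))
  have "\<exists>h. h \<in> {g. test_element D g} \<and> h \<in> U"
    if U: "openin (profinite_topology D) U" "x \<in> U" for x U
  proof -
    obtain V where V: "profinite_basic D V" "x \<in> V" "V \<subseteq> U"
      using U unfolding openin_profinite_topology[OF D] arbitrary_union_of_alt by blast
    then obtain g N where "g \<in> carrier D" "N \<lhd> D" "finite (rcosets\<^bsub>D\<^esub> N)" "V = g <#\<^bsub>D\<^esub> N"
      by (auto simp: profinite_basic_def)
    then show ?thesis
      using exists_test_element_in_coset[OF assms(2)] V(3) by blast
  qed
  then show ?thesis
    by (auto simp: closure_of_def)
qed


end
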